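(* Let $N\ge1$ be an integer, $p>1$, $q>1$, $p_1=\frac{2N}{N+1}$, $p_2=\frac{2N}{N+2}$, and assume $p_2<p<p_1$ (so $p<2$). Let $\delta=\frac{p}{2-p}$, $\eta=\frac{N-p}{p-1}$, and assume $\delta<\alpha$. For $a\in\mathbb{R}$ let $w(\cdot,a)$ be the solution of $$(|w'|^{p-2}w')'+\frac{N-1}{r}|w'|^{p-2}w'+rw'+\alpha w+|w|^{q-1}w=0\ \text{ in }(0,\infty),\qquad w(0)=a,\quad w'(0)=0.$$ If $\alpha<\eta$ (in particular if $\alpha\le N$), then any solution $w=w(\cdot,a)$ with $a\ne0$ has a finite number of zeros and satisfies either $$\lim_{r\to\infty}r^\delta w(r)=\pm\ell,\qquad \ell=\Big(\delta^{p-1}\frac{\delta-N}{\delta-\alpha}\Big)^{1/(2-p)},$$ or $$\lim_{r\to\infty}r^\eta w(r)=c\quad\text{for some }c\ne0.$$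
   Context: For every $a\in\mathbb{R}$ the initial value problem has a unique solution $w(\cdot,a)\in C^1([0,\infty))$ with $|w'|^{p-2}w'\in C^1([0,\infty))$. The sign $\pm$ depends on the solution. *)

theory Defs
  imports Complex_Main
begin

text \<open>
  A function \<open>f\<close> is of class \<open>C\<^sup>1\<close> on \<open>[0, \<infinity>)\<close> with derivative \<open>f'\<close>; at \<open>0\<close> the derivative is
  one-sided, and the values of \<open>f\<close> and \<open>f'\<close> on the negative half-line are irrelevant.
\<close>

definition C1_halfline :: "(real \<Rightarrow> real) \<Rightarrow> (real \<Rightarrow> real) \<Rightarrow> bool" where
  "C1_halfline f f' \<longleftrightarrow>
     (\<forall>r\<ge>0. (f has_real_derivative f' r) (at r within {0..})) \<and> continuous_on {0..} f'"

text \<open>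
  The map \<open>x \<mapsto> |x|\<^sup>m x\<close>. For \<open>m > -1\<close> it extends continuously by \<open>0\<close> to \<open>x = 0\<close>, and this is the
  value used here. The case \<open>-1 < m < 0\<close> occurs, with \<open>m = p - 2\<close>.
\<close>

definition signed_powr :: "real \<Rightarrow> real \<Rightarrow> real" where
  "signed_powr m x = \<bar>x\<bar> powr m * x"

text \<open>
  \<open>w\<close> solves the initial value problem: \<open>w\<close> and \<open>|w'|\<^bsup>p-2\<^esup> w'\<close> are of class \<open>C\<^sup>1\<close> on \<open>[0, \<infinity>)\<close>, with
  derivatives \<open>w'\<close> and \<open>F'\<close>, and the equation holds on the open half-line.
\<close>

definition ivp_solution ::
    "nat \<Rightarrow> real \<Rightarrow> real \<Rightarrow> real \<Rightarrow> real \<Rightarrow> (real \<Rightarrow> real) \<Rightarrow> bool" where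
  "ivp_solution N p q \<alpha> a w \<longleftrightarrow>
     (\<exists>w' F'. C1_halfline w w' \<and>
        C1_halfline (\<lambda>r. signed_powr (p - 2) (w' r)) F' \<and>
        (\<forall>r>0. F' r + (real N - 1) / r * signed_powr (p - 2) (w' r)
                 + r * w' r + \<alpha> * w r + signed_powr (q - 1) (w r) = 0) \<and>
        w 0 = a \<and> w' 0 = 0)"

end

theory Submission
  imports Defs "HOL-Analysis.Analysis"
begin

text \<open>
  The energy \<open>(p - 1) / p |w'|\<^sup>p + \<alpha> w\<^sup>2 / 2 + |w|\<^sup>q\<^sup>+\<^sup>1 / (q + 1)\<close> is nonincreasing and never vanishes, so
  the zeros of \<open>w\<close> are simple; moreover \<open>w \<rightarrow> 0\<close>. Where \<open>w > 0\<close>, put \<open>\<zeta> = - r w' / w\<close>. Once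
  \<open>|w|\<^sup>q\<^sup>-\<^sup>1 < \<eta> - \<alpha>\<close>, the slope \<open>\<zeta>\<close> can only cross \<open>\<eta>\<close> downwards, and \<open>r\<^sup>\<eta> w\<close> increases while
  \<open>\<zeta> < \<eta>\<close>. As \<open>\<zeta> = 0\<close> at an extremum, \<open>w\<close> has no zero after a late extremum, and \<open>w\<close> has
  finitely many zeros. If \<open>\<zeta> \<ge> \<eta>\<close> for all large \<open>r\<close>, then \<open>r\<^sup>\<eta> w\<close> decreases to a limit, which is positive
  because \<open>- r\<^sup>N\<^sup>-\<^sup>1 |w'|\<^sup>p\<^sup>-\<^sup>2 w'\<close> stays away from \<open>0\<close>. Otherwise \<open>\<zeta>\<close> and \<open>s = (r\<^sup>\<delta> w)\<^sup>2\<^sup>-\<^sup>p\<close> solve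
  an exponentially small perturbation of an autonomous predator-prey system, which has a Lyapunov
  function because \<open>\<alpha> < \<eta>\<close>; its equilibrium is \<open>\<zeta> = \<delta>\<close>, \<open>s = \<ell>\<^sup>2\<^sup>-\<^sup>p\<close>.
\<close>

section \<open>Differential inequalities on a half-line\<close>

text \<open>At the last time with \<open>f t \<le> c\<close> the value is exactly \<open>c\<close>
  by continuity, and \<open>f\<close> strictly decreases there, so it cannot be above
  \<open>c\<close> right afterwards.\<close>

lemma barrier:
  fixes f f' :: "real \<Rightarrow> real"
  assumes "a \<le> b"
    and deriv: "\<And>t. a \<le> t \<Longrightarrow> t \<le> b \<Longrightarrow> (f has_real_derivative f' t) (at t)"
    and init: "f a \<le> c"
    and neg: "\<And>t. a \<le> t \<Longrightarrow> t \<le> b \<Longrightarrow> f t = c \<Longrightarrow> f' t < 0"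
  shows "f b \<le> c"
proof (rule ccontr)
  assume fb: "\<not> f b \<le> c"
  define S where "S = {a..b} \<inter> f -` {..c}"
  have cont: "continuous_on {a..b} f"
    using deriv by (auto intro!: DERIV_atLeastAtMost_imp_continuous_on)
  have "closed S"
    unfolding S_def using cont by (intro continuous_closed_preimage) auto
  then have "compact S"
    unfolding S_def by (simp add: compact_eq_bounded_closed bounded_Int)
  moreover have "S \<noteq> {}"
    using init \<open>a \<le> b\<close> by (auto simp: S_def)
  ultimately obtain s where s: "s \<in> S" "\<And>t. t \<in> S \<Longrightarrow> t \<le> s"
    using compact_attains_sup by metis
  have sab: "a \<le> s" "s \<le> b" "f s \<le> c"
    using s(1) by (auto simp: S_def)
  have above: "c < f t" if "s < t" "t \<le> b" for t
    using s(2)[of t] that sab by (force simp: S_def)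
  have "s < b"
    using sab fb by (cases "s = b") auto
  have "f s = c"
  proof (rule ccontr)
    assume "f s \<noteq> c"
    moreover have "continuous_on {s..b} f"
      using cont sab by (elim continuous_on_subset) auto
    ultimately obtain t where "s \<le> t" "t \<le> b" "f t = c"
      using IVT'[of f s c b] sab fb by auto
    then show False
      using above[of t] \<open>f s \<noteq> c\<close> by (cases "s = t") auto
  qed
  then have "f' s < 0"
    using neg sab by auto
  then obtain d where d: "d > 0" "\<And>h. 0 < h \<Longrightarrow> h < d \<Longrightarrow> f (s + h) < f s"
    using DERIV_neg_dec_right[OF deriv[of s]] sab by auto
  have "f (s + min (d / 2) (b - s)) < f s"
    using d(1) \<open>s < b\<close> by (intro d(2)) auto
  moreover have "c < f (s + min (d / 2) (b - s))"
    using d(1) \<open>s < b\<close> by (intro above) auto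
  ultimately show False
    using \<open>f s = c\<close> by simp
qed

lemma first_hit:
  fixes f :: "real \<Rightarrow> real"
  assumes "a \<le> b" "continuous_on {a..b} f" "c < f a" "f b \<le> c"
  obtains s where "a < s" "s \<le> b" "f s = c" "\<And>t. a \<le> t \<Longrightarrow> t < s \<Longrightarrow> c < f t"
proof -
  define S where "S = {a..b} \<inter> f -` {..c}"
  have "closed S"
    unfolding S_def using assms by (intro continuous_closed_preimage) auto
  then have "compact S"
    unfolding S_def by (simp add: compact_eq_bounded_closed bounded_Int)
  moreover have "S \<noteq> {}"
    using assms by (auto simp: S_def)
  ultimately obtain s where s: "s \<in> S" "\<And>t. t \<in> S \<Longrightarrow> s \<le> t"
    using compact_attains_inf by metis
  have sab: "a \<le> s" "s \<le> b" "f s \<le> c"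
    using s(1) by (auto simp: S_def)
  have "continuous_on {a..s} f"
    using assms(2) sab by (elim continuous_on_subset) auto
  then obtain u where u: "a \<le> u" "u \<le> s" "f u = c"
    using IVT2'[of f s c a] sab assms by auto
  then have "u = s"
    using s(2)[of u] sab by (auto simp: S_def)
  show thesis
  proof (rule that)
    show "a < s"
      using sab assms by (cases "a = s") auto
    show "c < f t" if "a \<le> t" "t < s" for t
      using s(2)[of t] that sab by (force simp: S_def)
  qed (use sab u \<open>u = s\<close> in auto)
qed

lemma deriv_upper_bound_le:
  fixes f f' :: "real \<Rightarrow> real"
  assumes "a \<le> b"
    and "\<And>t. a \<le> t \<Longrightarrow> t \<le> b \<Longrightarrow> (f has_real_derivative f' t) (at t)"
    and "\<And>t. a \<le> t \<Longrightarrow> t \<le> b \<Longrightarrow> f' t \<le> k"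
  shows "f b \<le> f a + k * (b - a)"
proof -
  have "f b - k * b \<le> f a - k * a"
  proof (rule DERIV_nonpos_imp_nonincreasing[OF \<open>a \<le> b\<close>])
    fix t assume "a \<le> t" "t \<le> b"
    then show "\<exists>z. ((\<lambda>t. f t - k * t) has_real_derivative z) (at t) \<and> z \<le> 0"
      using assms(2,3) by (intro exI[of _ "f' t - k"]) (auto intro!: derivative_eq_intros)
  qed
  then show ?thesis
    by (simp add: algebra_simps)
qed

text \<open>While at or above \<open>k\<close>, \<open>f\<close> falls at speed at least
  \<open>c\<close>, so it reaches \<open>k\<close> in finite time; from then on
  \<open>barrier\<close> keeps it at or below \<open>k\<close>.\<close>

lemma eventually_le_of_deriv:
  fixes f f' :: "real \<Rightarrow> real"
  assumes deriv: "\<And>t. T \<le> t \<Longrightarrow> (f has_real_derivative f' t) (at t)"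
    and neg: "\<And>t. T \<le> t \<Longrightarrow> k \<le> f t \<Longrightarrow> f' t \<le> - c"
    and "0 < c"
  obtains T' where "T \<le> T'" "\<And>t. T' \<le> t \<Longrightarrow> f t \<le> k"
proof -
  have "\<exists>T'\<ge>T. f T' \<le> k"
  proof (rule ccontr)
    assume none: "\<not> ?thesis"
    define b where "b = T + (f T - k) / c"
    have above: "k \<le> f t" if "T \<le> t" for t
      using none that by force
    have "T \<le> b"
      using none \<open>0 < c\<close> by (auto simp: b_def not_le less_imp_le)
    then have "f b \<le> f T + (- c) * (b - T)"
      using deriv neg above by (intro deriv_upper_bound_le[where f' = f']) auto
    also have "\<dots> = k"
      using \<open>0 < c\<close> by (simp add: b_def)
    finally show False
      using none \<open>T \<le> b\<close> by auto
  qed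
  then obtain T' where T': "T \<le> T'" "f T' \<le> k"
    by auto
  have "f t \<le> k" if "T' \<le> t" for t
  proof (rule barrier[OF that, where f' = f'])
    show "f' u < 0" if "T' \<le> u" "u \<le> t" "f u = k" for u
      using neg[of u] that T' \<open>0 < c\<close> by auto
  qed (use deriv T' in auto)
  with that T' show thesis
    by blast
qed

lemma nonincreasing_bounded_tendsto:
  fixes f f' :: "real \<Rightarrow> real"
  assumes deriv: "\<And>t. T \<le> t \<Longrightarrow> (f has_real_derivative f' t) (at t)"
    and nonpos: "\<And>t. T \<le> t \<Longrightarrow> f' t \<le> 0"
    and bound: "\<And>t. T \<le> t \<Longrightarrow> m \<le> f t"
  obtains L where "m \<le> L" "(f \<longlongrightarrow> L) at_top"
proof -
  define L where "L = (INF t\<in>{T..}. f t)"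
  have bdd: "bdd_below (f ` {T..})"
    using bound by (intro bdd_belowI2[where m = m]) auto
  have "m \<le> L"
    unfolding L_def using bound by (intro cINF_greatest) auto
  moreover have "(f \<longlongrightarrow> L) at_top"
  proof (rule order_tendstoI)
    fix a assume "a < L"
    moreover have "L \<le> f t" if "T \<le> t" for t
      unfolding L_def using bdd that by (intro cINF_lower) auto
    ultimately show "\<forall>\<^sub>F t in at_top. a < f t"
      unfolding eventually_at_top_linorder by (intro exI[of _ T]) force
  next
    fix a assume "L < a"
    then obtain s where s: "T \<le> s" "f s < a"
      unfolding L_def using bdd by (subst (asm) cINF_less_iff) auto
    have "f t < a" if "s \<le> t" for t
      using deriv_upper_bound_le[OF that, of f f' 0] deriv nonpos s by force
    then show "\<forall>\<^sub>F t in at_top. f t < a"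
      unfolding eventually_at_top_linorder by auto
  qed
  ultimately show thesis
    using that by blast
qed

text \<open>A form of Barbalat's lemma: each time \<open>x\<close> reaches \<open>k\<close> it stays above \<open>k / 2\<close> long enough
  for \<open>U\<close> to drop by a fixed amount, so convergence of \<open>U\<close> allows this only finitely often.\<close>

lemma barbalat:
  fixes U U' x x' :: "real \<Rightarrow> real"
  assumes lim: "(U \<longlongrightarrow> L) at_top"
    and U: "\<And>t. T \<le> t \<Longrightarrow> (U has_real_derivative U' t) (at t)"
    and x: "\<And>t. T \<le> t \<Longrightarrow> (x has_real_derivative x' t) (at t)"
    and x': "\<And>t. T \<le> t \<Longrightarrow> - K \<le> x' t"
    and drop: "\<And>t. T \<le> t \<Longrightarrow> k / 2 \<le> x t \<Longrightarrow> U' t \<le> - c"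
    and pos: "0 < k" "0 < c"
  shows "\<forall>\<^sub>F t in at_top. x t < k"
proof -
  \<comment> \<open>\<open>K'\<close> is a positive speed bound, and \<open>h\<close> is a time span
    in which \<open>x\<close> can fall by at most \<open>k / 2\<close>.\<close>
  define K' where "K' = max K 1"
  define h where "h = k / (2 * K')"
  have h: "0 < h" "K' * h = k / 2"
    using pos by (auto simp: h_def K'_def)
  \<comment> \<open>Two values of \<open>U\<close> within \<open>c * h / 2\<close> of
    \<open>L\<close> differ by less than \<open>c * h\<close>, the drop that is forced over a time
    span \<open>h\<close>.\<close>
  have "0 < c * h / 2"
    using h pos by simp
  then have "\<forall>\<^sub>F t in at_top. dist (U t) L < c * h / 2"
    using lim by (simp only: tendsto_iff)
  then obtain S where S: "\<And>t. S \<le> t \<Longrightarrow> dist (U t) L < c * h / 2"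
    by (auto simp: eventually_at_top_linorder)
  have "x t < k" if t: "max S T \<le> t" for t
  proof (rule ccontr)
    assume "\<not> x t < k"
    have "k / 2 \<le> x u" if "t \<le> u" "u \<le> t + h" for u
    proof -
      have "- x u \<le> - x t + K' * (u - t)"
      proof (rule deriv_upper_bound_le[OF \<open>t \<le> u\<close>, where f' = "\<lambda>t. - x' t"])
        show "((\<lambda>t. - x t) has_real_derivative - x' s) (at s)" if "t \<le> s" for s
          using x t that by (auto intro!: DERIV_minus)
        show "- x' s \<le> K'" if "t \<le> s" for s
          using x'[of s] t that by (auto simp: K'_def)
      qed
      also have "K' * (u - t) \<le> K' * h"
        using that by (intro mult_left_mono) (auto simp: K'_def)
      finally show ?thesis
        using h \<open>\<not> x t < k\<close> by linarith
    qed
    then have "U (t + h) \<le> U t + (- c) * (t + h - t)"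
      using h t U drop by (intro deriv_upper_bound_le[where f' = U']) auto
    moreover have "dist (U t) L < c * h / 2" "dist (U (t + h)) L < c * h / 2"
      using t h by (intro S; simp)+
    ultimately show False
      unfolding dist_real_def abs_diff_less_iff by (simp add: algebra_simps)
  qed
  then show ?thesis
    unfolding eventually_at_top_linorder by blast
qed

section \<open>Signed powers\<close>

lemma signed_powr_pos: "0 < x \<Longrightarrow> signed_powr m x = x powr (m + 1)"
  by (simp add: signed_powr_def powr_add)

lemma signed_powr_0 [simp]: "signed_powr m 0 = 0"
  by (simp add: signed_powr_def)

lemma signed_powr_minus [simp]: "signed_powr m (- x) = - signed_powr m x"
  by (simp add: signed_powr_def)

lemma signed_powr_mult: "0 < c \<Longrightarrow> signed_powr m (c * x) = c powr (m + 1) * signed_powr m x"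
  by (simp add: signed_powr_def abs_mult powr_mult powr_add)

lemma signed_powr_less_iff:
  assumes "-1 < m"
  shows "signed_powr m x < signed_powr m y \<longleftrightarrow> x < y"
proof -
  have pos: "signed_powr m a < signed_powr m b" if "0 \<le> a" "a < b" for a b
    using that assms
    by (cases "a = 0") (auto simp: signed_powr_pos intro!: powr_less_mono2)
  have "signed_powr m a < signed_powr m b" if "a < b" for a b
  proof -
    consider "0 \<le> a" | "b \<le> 0" | "a < 0" "0 < b"
      by linarith
    then show ?thesis
    proof cases
      case 2
      then show ?thesis
        using pos[of "- b" "- a"] that by simp
    next
      case 3
      then show ?thesis
        using pos[of 0 "- a"] pos[of 0 b] by simp
    qed (use pos that in auto)
  qed
  then show ?thesis
    by (metis less_asym linorder_neqE_linordered_idom)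
qed

lemma signed_powr_le_iff: "-1 < m \<Longrightarrow> signed_powr m x \<le> signed_powr m y \<longleftrightarrow> x \<le> y"
  using signed_powr_less_iff[of m y x] by linarith

text \<open>Applied with \<open>m + 1 = 1 / (p - 1)\<close> and \<open>k + 1 = p - 1\<close>, this
  recovers \<open>w'\<close> from the flux \<open>signed_powr (p - 2) w'\<close>.\<close>

lemma signed_powr_inverse:
  assumes "(m + 1) * (k + 1) = 1"
  shows "signed_powr m (signed_powr k x) = x"
proof -
  have pos: "signed_powr m (signed_powr k x) = x" if "0 < x" for x
    using that assms by (simp add: signed_powr_pos powr_powr mult.commute)
  show ?thesis
    using pos[of x] pos[of "- x"] by (cases x "0 :: real" rule: linorder_cases) auto
qed

lemma continuous_on_signed_powr [continuous_intros]:
  assumes "0 < m" "continuous_on A f"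
  shows "continuous_on A (\<lambda>x. signed_powr m (f x))"
  unfolding signed_powr_def using assms by (intro continuous_intros continuous_on_powr') auto

text \<open>The formula persists at \<open>x = 0\<close>, where the difference quotient has modulus
  \<open>\<bar>h\<bar> powr (b - 1)\<close>. This lets the energy be differentiated at zeros of
  \<open>w\<close> and of the flux.\<close>

lemma DERIV_abs_powr:
  assumes "1 < b"
  shows "((\<lambda>x. \<bar>x\<bar> powr b) has_real_derivative b * signed_powr (b - 2) x) (at x)"
proof -
  have pos: "((\<lambda>x. \<bar>x\<bar> powr b) has_real_derivative b * signed_powr (b - 2) x) (at x)" if "0 < x" for x
  proof -
    have "((\<lambda>x. x powr b) has_real_derivative b * x powr (b - 1)) (at x)"
      using that by (rule has_real_derivative_powr)
    moreover have "\<forall>\<^sub>F u in nhds x. u powr b = \<bar>u\<bar> powr b"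
      using that by (intro eventually_mono[OF eventually_nhds_in_open[of "{0<..}" x]]) auto
    ultimately show ?thesis
      using that DERIV_cong_ev[OF refl, of "\<lambda>u. u powr b" "\<lambda>u. \<bar>u\<bar> powr b" x]
      by (simp add: signed_powr_pos)
  qed
  consider "0 < x" | "x < 0" | "x = 0"
    by linarith
  then show ?thesis
  proof cases
    case 2
    then have "((\<lambda>x. \<bar>- x\<bar> powr b) has_real_derivative b * signed_powr (b - 2) (- x) * (- 1)) (at x)"
      by (intro DERIV_chain'[where g = "\<lambda>x. \<bar>x\<bar> powr b"] pos derivative_eq_intros) auto
    then show ?thesis
      by simp
  next
    case 3
    have "((\<lambda>h. \<bar>\<bar>h\<bar> powr b / h\<bar>) \<longlongrightarrow> 0) (at 0)"
    proof (rule Lim_transform_eventually)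
      have "((\<lambda>h::real. \<bar>h\<bar> powr (b - 1)) \<longlongrightarrow> \<bar>0\<bar> powr (b - 1)) (at 0)"
        using assms by (intro tendsto_intros tendsto_powr') auto
      then show "((\<lambda>h::real. \<bar>h\<bar> powr (b - 1)) \<longlongrightarrow> 0) (at 0)"
        by simp
      show "\<forall>\<^sub>F h::real in at 0. \<bar>h\<bar> powr (b - 1) = \<bar>\<bar>h\<bar> powr b / h\<bar>"
        by (auto simp: eventually_at powr_diff intro!: exI[of _ 1])
    qed
    then have "((\<lambda>h. \<bar>h\<bar> powr b / h) \<longlongrightarrow> 0) (at (0::real))"
      by (simp only: tendsto_rabs_zero_iff)
    then show ?thesis
      using 3 by (simp add: DERIV_def)
  qed (use pos in auto)
qed

section \<open>The positive phase\<close>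

text \<open>With \<open>t = ln r\<close>, \<open>y = r\<^sup>\<delta> w\<close>, \<open>\<zeta> = - r w' / w\<close> and \<open>x = |\<zeta>|\<^sup>p\<^sup>-\<^sup>2 \<zeta>\<close>, the equation becomes the
  system below where \<open>w > 0\<close>. The term \<open>exp (- \<kappa> t) y\<^sup>k\<close> is \<open>|w|\<^sup>q\<^sup>-\<^sup>1\<close>, for \<open>\<kappa> = \<delta> (q - 1)\<close> and
  \<open>k = q - 1\<close>. In terms of \<open>x\<close> the vector field is regular at \<open>\<zeta> = 0\<close>.\<close>

locale positive_phase =
  fixes p \<delta> \<alpha> \<eta> \<kappa> k m T :: real and y x :: "real \<Rightarrow> real"
  assumes p: "1 < p" "p < 2"
    and exps: "0 < \<delta>" "\<delta> < \<alpha>" "\<alpha> < \<eta>"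
    and \<kappa>: "0 < \<kappa>" and k: "0 < k"
    and m: "0 < m" "signed_powr ((2 - p) / (p - 1)) m < \<eta>"
    and y_pos: "\<And>t. T \<le> t \<Longrightarrow> 0 < y t"
    and x_le: "\<And>t. T \<le> t \<Longrightarrow> x t \<le> m"
    and y_deriv: "\<And>t. T \<le> t \<Longrightarrow>
      (y has_real_derivative y t * (\<delta> - signed_powr ((2 - p) / (p - 1)) (x t))) (at t)"
    and x_deriv: "\<And>t. T \<le> t \<Longrightarrow>
      (x has_real_derivative
        y t powr (2 - p) * (\<alpha> + exp (- \<kappa> * t) * y t powr k - signed_powr ((2 - p) / (p - 1)) (x t))
        - (p - 1) * x t * (\<eta> - signed_powr ((2 - p) / (p - 1)) (x t))) (at t)"
begin

text \<open>Inverse of the map from \<zeta> to \<open>x\<close>, so that \<open>g (x t)\<close> is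
  the slope \<zeta>.\<close>

definition g :: "real \<Rightarrow> real" where
  "g = signed_powr ((2 - p) / (p - 1))"

definition e :: "real \<Rightarrow> real" where
  "e t = exp (- \<kappa> * t) * y t powr k"

definition s :: "real \<Rightarrow> real" where
  "s t = y t powr (2 - p)"

text \<open>Equilibrium of the system without the exponential term:
  \<open>g x\<^sub>0 = \<delta>\<close> makes \<open>y\<close> stationary, and
  \<open>s\<^sub>0\<close> below then makes \<open>x\<close> stationary.\<close>

definition x\<^sub>0 :: real where
  "x\<^sub>0 = \<delta> powr (p - 1)"

definition s\<^sub>0 :: real where
  "s\<^sub>0 = (p - 1) * x\<^sub>0 * (\<eta> - \<delta>) / (\<alpha> - \<delta>)"

section \<open>Equations of motion and properties of the slope map\<close>

lemma y_deriv': "T \<le> t \<Longrightarrow> (y has_real_derivative y t * (\<delta> - g (x t))) (at t)"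
  using y_deriv by (simp add: g_def)

lemma x_deriv':
  "T \<le> t \<Longrightarrow> (x has_real_derivative s t * (\<alpha> + e t - g (x t)) - (p - 1) * x t * (\<eta> - g (x t))) (at t)"
  using x_deriv by (simp add: g_def s_def e_def)

lemma s_deriv:
  assumes "T \<le> t"
  shows "(s has_real_derivative (2 - p) * s t * (\<delta> - g (x t))) (at t)"
proof -
  have "y t powr (1 - p) * y t = s t"
    using powr_add[of "y t" "1 - p" 1] y_pos[OF assms] by (simp add: s_def)
  moreover have "((\<lambda>t. y t powr (2 - p)) has_real_derivative
      (2 - p) * y t powr (2 - p - 1) * (y t * (\<delta> - g (x t)))) (at t)"
    using y_pos[OF assms]
    by (intro DERIV_chain2[OF has_real_derivative_powr y_deriv'[OF assms]])
  moreover have "(2 - p) * y t powr (2 - p - 1) * (y t * (\<delta> - g (x t)))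
      = (2 - p) * (y t powr (1 - p) * y t) * (\<delta> - g (x t))"
    by simp
  ultimately show ?thesis
    by (simp only: s_def[abs_def])
qed

lemma s_pos: "T \<le> t \<Longrightarrow> 0 < s t"
  using y_pos[of t] by (simp add: s_def)

lemma e_nonneg: "0 \<le> e t"
  by (simp add: e_def)

lemma exponent: "-1 < (2 - p) / (p - 1)" "0 < (2 - p) / (p - 1)" "(2 - p) / (p - 1) + 1 = 1 / (p - 1)"
  using p by (auto simp: field_simps)

lemma g_less_iff: "g a < g b \<longleftrightarrow> a < b"
  unfolding g_def by (rule signed_powr_less_iff) (rule exponent)

lemma g_le_iff: "g a \<le> g b \<longleftrightarrow> a \<le> b"
  unfolding g_def by (rule signed_powr_le_iff) (rule exponent)

lemma g_0 [simp]: "g 0 = 0"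
  by (simp add: g_def)

lemma g_minus [simp]: "g (- a) = - g a"
  by (simp add: g_def)

lemma g_powr: "0 < a \<Longrightarrow> g (a powr (p - 1)) = a"
  using p by (simp add: g_def signed_powr_pos exponent powr_powr)

lemma continuous_on_g: "continuous_on A f \<Longrightarrow> continuous_on A (\<lambda>u. g (f u))"
  unfolding g_def using exponent by (intro continuous_intros)

lemma g_x\<^sub>0: "g x\<^sub>0 = \<delta>"
  using exps by (simp add: x\<^sub>0_def g_powr)

lemma x\<^sub>0_pos: "0 < x\<^sub>0"
  using exps by (simp add: x\<^sub>0_def)

lemma s\<^sub>0_pos: "0 < s\<^sub>0"
  using exps p x\<^sub>0_pos by (simp add: s\<^sub>0_def)

section \<open>A priori bounds on the trajectory\<close>

lemma y_bounded:
  obtains Y where "0 < Y" "\<And>t. T \<le> t \<Longrightarrow> y t \<le> Y"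
proof -
  \<comment> \<open>In the original variables \<open>D\<close> is
    \<open>r powr \<delta> * (w + F / r)\<close>, with \<open>F\<close> the flux. All terms
    containing \<open>g\<close> cancel in its derivative, which leaves a loss at least linear in
    \<open>y\<close> against a gain of order \<open>y powr (p - 1)\<close>, where
    \<open>p - 1 < 1\<close>.\<close>
  define D where "D t = y t - x t * y t powr (p - 1)" for t
  \<comment> \<open>\<open>K\<close> is the value of \<open>y\<close> at which
    \<open>(\<alpha> - \<delta>) * y\<close> balances
    \<open>(p - 1) * (\<eta> - \<delta>) * m * y powr (p - 1)\<close>.\<close>
  define K where "K = ((p - 1) * (\<eta> - \<delta>) * m / (\<alpha> - \<delta>)) powr (1 / (2 - p))"
  define M where "M = max K (D T)"
  have "0 \<le> M"
    by (auto simp: M_def K_def le_max_iff_disj)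
  have D_deriv: "(D has_real_derivative
      (p - 1) * (\<eta> - \<delta>) * (x t * y t powr (p - 1)) - (\<alpha> + e t - \<delta>) * y t) (at t)" if "T \<le> t" for t
  proof -
    have powrs: "y t powr (p - 2) * y t = y t powr (p - 1)" "s t * y t powr (p - 1) = y t"
      using powr_add[of "y t" "p - 2" 1] powr_add[of "y t" "2 - p" "p - 1"] y_pos[OF that]
      by (simp_all add: s_def)
    have "((\<lambda>t. y t powr (p - 1)) has_real_derivative
        (p - 1) * y t powr (p - 1 - 1) * (y t * (\<delta> - g (x t)))) (at t)"
      using y_pos[OF that]
      by (intro DERIV_chain2[OF has_real_derivative_powr y_deriv'[OF that]])
    also have "(p - 1) * y t powr (p - 1 - 1) * (y t * (\<delta> - g (x t)))
        = (p - 1) * (y t powr (p - 2) * y t) * (\<delta> - g (x t))"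
      by simp
    finally have P: "((\<lambda>t. y t powr (p - 1)) has_real_derivative
        (p - 1) * y t powr (p - 1) * (\<delta> - g (x t))) (at t)"
      by (simp only: powrs)
    have "y t * (\<delta> - g (x t)) - (x t * ((p - 1) * y t powr (p - 1) * (\<delta> - g (x t)))
        + (s t * (\<alpha> + e t - g (x t)) - (p - 1) * x t * (\<eta> - g (x t))) * y t powr (p - 1))
      = y t * (\<delta> - g (x t)) - (s t * y t powr (p - 1)) * (\<alpha> + e t - g (x t))
        + (p - 1) * (\<eta> - \<delta>) * (x t * y t powr (p - 1))"
      by (simp add: algebra_simps)
    also have "\<dots> = (p - 1) * (\<eta> - \<delta>) * (x t * y t powr (p - 1)) - (\<alpha> + e t - \<delta>) * y t"
      unfolding powrs by (simp add: algebra_simps)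
    finally show ?thesis
      unfolding D_def using DERIV_diff[OF y_deriv'[OF that] DERIV_mult'[OF x_deriv'[OF that] P]] by simp
  qed
  have D_le: "D t \<le> M" if "T \<le> t" for t
  proof (rule barrier[OF that D_deriv])
    show "D T \<le> M"
      by (simp add: M_def)
    fix u assume u: "T \<le> u" "D u = M"
    have "(p - 1) * (\<eta> - \<delta>) * (x u * y u powr (p - 1)) < (\<alpha> - \<delta>) * y u"
    proof (cases "0 < x u")
      case False
      then have "(p - 1) * (\<eta> - \<delta>) * (x u * y u powr (p - 1)) \<le> 0"
        using p exps by (intro mult_nonneg_nonpos mult_nonpos_nonneg) auto
      then show ?thesis
        using exps y_pos[OF u(1)] by (smt (verit) mult_pos_pos)
    next
      case True
      then have "0 < x u * y u powr (p - 1)"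
        using y_pos[OF u(1)] by simp
      \<comment> \<open>For positive \<open>x u\<close> the value \<open>y u\<close> exceeds
        \<open>D u = M\<close>, which is at least \<open>K\<close>.\<close>
      then have "K < y u"
        using u(2) unfolding D_def M_def by linarith
      then have "K powr (2 - p) < y u powr (2 - p)"
        using p by (intro powr_less_mono2) (auto simp: K_def)
      then have c: "(p - 1) * (\<eta> - \<delta>) * m / (\<alpha> - \<delta>) < y u powr (2 - p)"
        using p exps m by (simp add: K_def powr_powr)
      have "(p - 1) * (\<eta> - \<delta>) * (x u * y u powr (p - 1))
          \<le> (p - 1) * (\<eta> - \<delta>) * (m * y u powr (p - 1))"
        using p exps x_le[OF u(1)] by (intro mult_left_mono mult_right_mono) auto
      also have "\<dots> = (\<alpha> - \<delta>) * ((p - 1) * (\<eta> - \<delta>) * m / (\<alpha> - \<delta>) * y u powr (p - 1))"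
        using exps by (simp add: field_simps)
      also have "\<dots> < (\<alpha> - \<delta>) * (y u powr (2 - p) * y u powr (p - 1))"
        using exps y_pos[OF u(1)] c by (intro mult_strict_left_mono mult_strict_right_mono) auto
      also have "y u powr (2 - p) * y u powr (p - 1) = y u"
        using powr_add[of "y u" "2 - p" "p - 1"] y_pos[OF u(1)] by simp
      finally show ?thesis .
    qed
    also have "\<dots> \<le> (\<alpha> + e u - \<delta>) * y u"
      using e_nonneg y_pos[OF u(1)] by (intro mult_right_mono) auto
    finally show "(p - 1) * (\<eta> - \<delta>) * (x u * y u powr (p - 1)) - (\<alpha> + e u - \<delta>) * y u < 0"
      by simp
  qed
  \<comment> \<open>Above \<open>Y\<close>, the second entry makes
    \<open>y t powr (2 - p) - x t\<close> larger than 1, and then the first entry makes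
    \<open>D t\<close> larger than \<open>M\<close>.\<close>
  define Y where "Y = max (M powr (1 / (p - 1))) ((m + 1) powr (1 / (2 - p)))"
  have "0 < Y"
    using m by (simp add: Y_def less_max_iff_disj)
  have "y t \<le> Y" if t: "T \<le> t" for t
  proof (rule ccontr)
    assume "\<not> y t \<le> Y"
    then have "M powr (1 / (p - 1)) < y t" "(m + 1) powr (1 / (2 - p)) < y t"
      by (auto simp: Y_def)
    then have "(M powr (1 / (p - 1))) powr (p - 1) < y t powr (p - 1)"
        "((m + 1) powr (1 / (2 - p))) powr (2 - p) < y t powr (2 - p)"
      using p by (auto intro!: powr_less_mono2)
    then have big: "M < y t powr (p - 1)" "m + 1 < y t powr (2 - p)"
      using p \<open>0 \<le> M\<close> m by (auto simp: powr_powr)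
    have "M < y t powr (p - 1) * 1"
      using big by simp
    also have "\<dots> \<le> y t powr (p - 1) * (y t powr (2 - p) - x t)"
      using big x_le[OF t] by (intro mult_left_mono) auto
    also have "\<dots> = D t"
      using powr_add[of "y t" "p - 1" "2 - p"] y_pos[OF t] by (simp add: D_def algebra_simps)
    finally show False
      using D_le[OF t] by simp
  qed
  with \<open>0 < Y\<close> that show thesis
    by blast
qed

lemma s_bounded:
  obtains S where "0 < S" "\<And>t. T \<le> t \<Longrightarrow> s t \<le> S"
proof -
  obtain Y where Y: "0 < Y" "\<And>t. T \<le> t \<Longrightarrow> y t \<le> Y"
    using y_bounded by blast
  show thesis
  proof (rule that)
    show "0 < Y powr (2 - p)"
      using Y by simp
    show "s t \<le> Y powr (2 - p)" if "T \<le> t" for t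
      unfolding s_def using p Y that y_pos[OF that] by (intro powr_mono2) auto
  qed
qed

lemma e_bounded:
  obtains C where "0 < C" "\<And>t. T \<le> t \<Longrightarrow> e t \<le> C * exp (- \<kappa> * t)"
proof -
  obtain Y where Y: "0 < Y" "\<And>t. T \<le> t \<Longrightarrow> y t \<le> Y"
    using y_bounded by blast
  show thesis
  proof (rule that)
    show "0 < Y powr k"
      using Y by simp
    show "e t \<le> Y powr k * exp (- \<kappa> * t)" if "T \<le> t" for t
      unfolding e_def using k Y that y_pos[OF that]
      by (subst mult.commute, intro mult_right_mono powr_mono2) auto
  qed
qed

lemma exp_decay: "((\<lambda>t. c * exp (- \<kappa> * t)) \<longlongrightarrow> 0) at_top"
proof -
  have "LIM t at_top. - \<kappa> * t :> at_bot"
    using \<kappa> by (intro filterlim_tendsto_neg_mult_at_bot[OF tendsto_const]) (auto simp: filterlim_ident)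
  then have "((\<lambda>t. exp (- \<kappa> * t)) \<longlongrightarrow> 0) at_top"
    by (rule filterlim_compose[OF exp_at_bot])
  then show ?thesis
    by (rule tendsto_mult_right_zero)
qed

lemma e_tendsto: "(e \<longlongrightarrow> 0) at_top"
proof -
  obtain C where C: "0 < C" "\<And>t. T \<le> t \<Longrightarrow> e t \<le> C * exp (- \<kappa> * t)"
    using e_bounded by blast
  show ?thesis
  proof (rule tendsto_sandwich[OF _ _ tendsto_const exp_decay])
    show "\<forall>\<^sub>F t in at_top. e t \<le> C * exp (- \<kappa> * t)"
      unfolding eventually_at_top_linorder using C by auto
  qed (simp add: e_nonneg)
qed

text \<open>The upper bound is \<open>m\<close>. From below, \<open>x\<close> has positive
  derivative wherever \<open>x \<le> 0\<close>: the first term is positive and the subtracted one is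
  at most 0.\<close>

lemma x_bounded:
  obtains R where "0 < R" "\<And>t. T \<le> t \<Longrightarrow> \<bar>x t\<bar> \<le> R"
proof -
  define X where "X = max (- x T) 0"
  have "- x t \<le> X" if t: "T \<le> t" for t
  proof (rule barrier[OF t DERIV_minus[OF x_deriv']])
    show "- x T \<le> X"
      by (simp add: X_def)
    fix u assume u: "T \<le> u" "- x u = X"
    then have "x u \<le> 0"
      by (auto simp: X_def)
    then have "g (x u) \<le> 0"
      using g_le_iff[of "x u" 0] by simp
    then have "0 < s u * (\<alpha> + e u - g (x u))"
      using s_pos[OF u(1)] e_nonneg[of u] exps by (intro mult_pos_pos) auto
    moreover have "(p - 1) * x u * (\<eta> - g (x u)) \<le> 0"
      using \<open>x u \<le> 0\<close> \<open>g (x u) \<le> 0\<close> p exps by (intro mult_nonpos_nonneg mult_nonneg_nonpos) auto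
    ultimately show "- (s u * (\<alpha> + e u - g (x u)) - (p - 1) * x u * (\<eta> - g (x u))) < 0"
      by simp
  qed
  then show thesis
    using that[of "max X m"] m x_le by (force simp: less_max_iff_disj)
qed

text \<open>This keeps \<open>\<alpha> - g (x t)\<close> away from 0, since the Lyapunov function
  divides by it. When \<open>g (x t)\<close> is near or above \<alpha>, the first term of the
  derivative of \<open>x\<close> is small or negative, while the second pulls \<open>x\<close> down
  because \<open>x t \<le> m\<close>.\<close>

lemma x_eventually_le:
  obtains z T' where "T \<le> T'" "\<delta> < g z" "g z < \<alpha>" "\<And>t. T' \<le> t \<Longrightarrow> x t \<le> z"
proof -
  obtain S where S: "0 < S" "\<And>t. T \<le> t \<Longrightarrow> s t \<le> S"
    using s_bounded by blast
  \<comment> \<open>\<open>c\<close> bounds the subtracted term from below as long as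
    \<open>x\<^sub>0 \<le> x t \<le> m\<close>. With \<open>b = c / (4 * S)\<close>, the bounds
    \<open>e t < b\<close> and \<open>\<alpha> - g (x t) \<le> b\<close> limit the first term to
    \<open>c / 2\<close>.\<close>
  define c where "c = (p - 1) * x\<^sub>0 * (\<eta> - g m)"
  have "0 < c"
    using p x\<^sub>0_pos m by (simp add: c_def g_def)
  define b where "b = c / (4 * S)"
  have "0 < b"
    using S \<open>0 < c\<close> by (simp add: b_def)
  define \<beta> where "\<beta> = max ((\<alpha> + \<delta>) / 2) (\<alpha> - b)"
  have \<beta>: "\<delta> < \<beta>" "\<beta> < \<alpha>" "\<alpha> - b \<le> \<beta>"
    using exps \<open>0 < b\<close> by (auto simp: \<beta>_def less_max_iff_disj field_simps)
  define z where "z = \<beta> powr (p - 1)"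
  have gz: "g z = \<beta>"
    using \<beta> exps by (simp add: z_def g_powr)
  have "x\<^sub>0 \<le> z"
    using g_le_iff[of x\<^sub>0 z] \<beta> by (simp add: gz g_x\<^sub>0)
  have "\<forall>\<^sub>F t in at_top. e t < b"
    using order_tendstoD(2)[OF e_tendsto \<open>0 < b\<close>] .
  then obtain T1 where T1: "\<And>t. T1 \<le> t \<Longrightarrow> e t < b"
    by (auto simp: eventually_at_top_linorder)
  have "s t * (\<alpha> + e t - g (x t)) - (p - 1) * x t * (\<eta> - g (x t)) \<le> - (c / 2)"
    if t: "max T T1 \<le> t" "z \<le> x t" for t
  proof -
    have "\<beta> \<le> g (x t)"
      using t g_le_iff[of z "x t"] gz by simp
    then have "\<alpha> + e t - g (x t) \<le> 2 * b"
      using \<beta> T1[of t] t by auto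
    then have "s t * (\<alpha> + e t - g (x t)) \<le> s t * (2 * b)"
      using s_pos[of t] t by (intro mult_left_mono) auto
    also have "\<dots> \<le> S * (2 * b)"
      using S t \<open>0 < b\<close> by (intro mult_right_mono) auto
    also have "\<dots> = c / 2"
      using S by (simp add: b_def)
    finally have "s t * (\<alpha> + e t - g (x t)) \<le> c / 2" .
    moreover have "c \<le> (p - 1) * x t * (\<eta> - g (x t))"
      unfolding c_def using p x\<^sub>0_pos \<open>x\<^sub>0 \<le> z\<close> t x_le[of t] g_le_iff[of "x t" m] m
      by (intro mult_mono mult_nonneg_nonneg) (auto simp: g_def)
    ultimately show ?thesis
      by simp
  qed
  moreover have "(x has_real_derivative s t * (\<alpha> + e t - g (x t)) - (p - 1) * x t * (\<eta> - g (x t))) (at t)"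
    if "max T T1 \<le> t" for t
    using x_deriv' that by simp
  ultimately obtain T' where "max T T1 \<le> T'" "\<And>t. T' \<le> t \<Longrightarrow> x t \<le> z"
    using eventually_le_of_deriv[of "max T T1" x
        "\<lambda>t. s t * (\<alpha> + e t - g (x t)) - (p - 1) * x t * (\<eta> - g (x t))" z "c / 2"] \<open>0 < c\<close> by auto
  then show thesis
    using that[of T' z] gz \<beta> by auto
qed

text \<open>The quotient is the nullcline of \<open>x\<close>, with value \<open>s\<^sub>0\<close>
  at \<open>x\<^sub>0\<close>. Its factor \<open>(\<eta> - g u) / (\<alpha> - g u)\<close> is at
  least 1 and increases with \<open>u\<close> because \<open>\<alpha> < \<eta>\<close>, so on both
  sides the nullcline departs from \<open>s\<^sub>0\<close> at least like
  \<open>(p - 1) * (u - x\<^sub>0)\<close>.\<close>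

lemma h_minus_s\<^sub>0:
  assumes "g u < \<alpha>"
  shows "(p - 1) * ((g u - \<delta>) * (u - x\<^sub>0)) \<le> (g u - \<delta>) * ((p - 1) * u * (\<eta> - g u) / (\<alpha> - g u) - s\<^sub>0)"
    (is "_ \<le> _ * (?h - _)")
proof -
  define \<rho> where "\<rho> = (\<eta> - \<delta>) / (\<alpha> - \<delta>)"
  have "1 < \<rho>"
    using exps by (simp add: \<rho>_def)
  have s\<^sub>0: "s\<^sub>0 = (p - 1) * (x\<^sub>0 * \<rho>)"
    by (simp add: s\<^sub>0_def \<rho>_def)
  have h: "?h = (p - 1) * (u * ((\<eta> - g u) / (\<alpha> - g u)))"
    by simp
  have ratio: "(\<eta> - a) / (\<alpha> - a) = 1 + (\<eta> - \<alpha>) / (\<alpha> - a)" if "a < \<alpha>" for a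
    using that by (simp add: field_simps)
  have mono: "(\<eta> - a) / (\<alpha> - a) \<le> (\<eta> - b) / (\<alpha> - b)" if "a \<le> b" "b < \<alpha>" for a b
    using that exps by (simp add: ratio frac_le)
  have one: "1 \<le> (\<eta> - g u) / (\<alpha> - g u)"
    using assms exps by (simp add: ratio)
  show ?thesis
  proof (cases "x\<^sub>0 \<le> u")
    case True
    then have "\<delta> \<le> g u"
      using g_le_iff[of x\<^sub>0 u] by (simp add: g_x\<^sub>0)
    have "u - x\<^sub>0 \<le> (u - x\<^sub>0) * \<rho>"
      using True \<open>1 < \<rho>\<close> by (intro mult_le_cancel_left1[THEN iffD2]) auto
    also have "\<dots> \<le> u * ((\<eta> - g u) / (\<alpha> - g u)) - x\<^sub>0 * \<rho>"
      using mult_left_mono[OF mono[OF \<open>\<delta> \<le> g u\<close> assms], of u] True x\<^sub>0_pos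
      by (simp add: left_diff_distrib flip: \<rho>_def)
    finally have "(g u - \<delta>) * ((p - 1) * (u - x\<^sub>0))
        \<le> (g u - \<delta>) * ((p - 1) * (u * ((\<eta> - g u) / (\<alpha> - g u)) - x\<^sub>0 * \<rho>))"
      using p \<open>\<delta> \<le> g u\<close> by (intro mult_left_mono) auto
    then show ?thesis
      unfolding h s\<^sub>0 by (simp add: algebra_simps)
  next
    case False
    then have "g u \<le> \<delta>"
      using g_le_iff[of u x\<^sub>0] by (simp add: g_x\<^sub>0)
    have "u * ((\<eta> - g u) / (\<alpha> - g u)) - x\<^sub>0 * \<rho> \<le> u - x\<^sub>0"
    proof (cases "0 \<le> u")
      case True
      have "u * ((\<eta> - g u) / (\<alpha> - g u)) \<le> u * \<rho>"
        using mono[OF \<open>g u \<le> \<delta>\<close>] exps True by (intro mult_left_mono) (auto simp: \<rho>_def)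
      moreover have "(u - x\<^sub>0) * \<rho> \<le> (u - x\<^sub>0) * 1"
        using False \<open>1 < \<rho>\<close> by (intro mult_left_mono_neg) auto
      ultimately show ?thesis
        by (simp add: algebra_simps)
    next
      case neg: False
      \<comment> \<open>For negative \<open>u\<close> monotonicity of the factor points the wrong
        way; its lower bound 1 serves instead.\<close>
      have "u * ((\<eta> - g u) / (\<alpha> - g u)) \<le> u * 1"
        using neg one by (intro mult_left_mono_neg) auto
      moreover have "x\<^sub>0 * 1 \<le> x\<^sub>0 * \<rho>"
        using x\<^sub>0_pos \<open>1 < \<rho>\<close> by (intro mult_left_mono) auto
      ultimately show ?thesis
        by simp
    qed
    then have "(g u - \<delta>) * ((p - 1) * (u - x\<^sub>0))
        \<le> (g u - \<delta>) * ((p - 1) * (u * ((\<eta> - g u) / (\<alpha> - g u)) - x\<^sub>0 * \<rho>))"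
      using p \<open>g u \<le> \<delta>\<close> by (intro mult_left_mono_neg mult_left_mono) auto
    then show ?thesis
      unfolding h s\<^sub>0 by (simp add: algebra_simps)
  qed
qed

text \<open>Read as a predator-prey system of Gause type in \<open>s\<close> and \<open>g x\<close>, the unperturbed flow has the
  Lyapunov function \<open>(s - s\<^sub>0 ln s) / (2 - p) + B x\<close> with \<open>B' = (g - \<delta>) / (\<alpha> - g)\<close>. It decreases
  because the nullcline \<open>s = (p - 1) x (\<eta> - g x) / (\<alpha> - g x)\<close> is increasing, which is where
  \<open>\<alpha> < \<eta>\<close> enters. The exponential term absorbs the perturbation.\<close>

lemma lyapunov:
  "\<exists>U U' L T'. T \<le> T' \<and> (U \<longlongrightarrow> L) at_top \<and>
    (\<forall>t\<ge>T'. (U has_real_derivative U' t) (at t) \<and>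
      U' t \<le> - ((p - 1) * ((g (x t) - \<delta>) * (x t - x\<^sub>0))))"
proof -
  obtain S where S: "0 < S" "\<And>t. T \<le> t \<Longrightarrow> s t \<le> S"
    using s_bounded by blast
  obtain E where E: "0 < E" "\<And>t. T \<le> t \<Longrightarrow> e t \<le> E * exp (- \<kappa> * t)"
    using e_bounded by blast
  obtain R where R: "0 < R" "\<And>t. T \<le> t \<Longrightarrow> \<bar>x t\<bar> \<le> R"
    using x_bounded by blast
  obtain z T' where z: "T \<le> T'" "\<delta> < g z" "g z < \<alpha>" "\<And>t. T' \<le> t \<Longrightarrow> x t \<le> z"
    using x_eventually_le by blast
  \<comment> \<open>Clipping at \<open>z\<close> keeps the denominator positive on the whole
    interval where \<open>B\<close> is built; along the trajectory \<open>x t \<le> z\<close> holds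
    from \<open>T'\<close> on, so nothing is changed there.\<close>
  define f where "f u = (g (min u z) - \<delta>) / (\<alpha> - g (min u z))" for u
  have g_min: "g (min u z) < \<alpha>" for u
    using z g_le_iff[of "min u z" z] by (simp add: order_le_less_trans)
  \<comment> \<open>The margin 1 makes every \<open>u\<close> with
    \<open>\<bar>u\<bar> \<le> R\<close> an interior point, where the derivative of \<open>B\<close>
    is two-sided.\<close>
  have "continuous_on {- R - 1..R + 1} f"
    unfolding f_def using g_min
    by (intro continuous_intros continuous_on_g) (auto simp: less_imp_neq[symmetric])
  then obtain B where B: "\<And>u. u \<in> {- R - 1..R + 1} \<Longrightarrow>
      (B has_vector_derivative f u) (at u within {- R - 1..R + 1})"
    using antiderivative_continuous by metis
  have B_deriv: "(B has_real_derivative f u) (at u)" if "\<bar>u\<bar> \<le> R" for u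
  proof -
    have "at u within {- R - 1..R + 1} = at u"
      using that by (intro at_within_interior) auto
    then show ?thesis
      using B[of u] that by (simp add: has_real_derivative_iff_has_vector_derivative abs_le_iff)
  qed
  have "continuous_on {- R..R} B"
    using B_deriv by (intro DERIV_atLeastAtMost_imp_continuous_on) force
  then have "bounded (B ` {- R..R})"
    by (intro compact_imp_bounded compact_continuous_image) auto
  then obtain b where b: "\<And>u. \<bar>u\<bar> \<le> R \<Longrightarrow> \<bar>B u\<bar> \<le> b"
    unfolding bounded_iff by (force simp: abs_le_iff)
  \<comment> \<open>Product of the bounds for \<open>f (x t)\<close>, \<open>s t\<close> and the
    coefficient of \<open>e t\<close>: the perturbation contributes at most
    \<open>C * exp (- \<kappa> * t)\<close>.\<close>
  define C where "C = \<alpha> / (\<alpha> - g z) * (S * E)"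
  have "0 < C"
    using z S E exps by (simp add: C_def)
  define U where "U t = (s t - s\<^sub>0 * ln (s t)) / (2 - p) + B (x t) + C / \<kappa> * exp (- \<kappa> * t)" for t
  define U' where "U' t = (s t - s\<^sub>0) * (\<delta> - g (x t))
      + f (x t) * (s t * (\<alpha> + e t - g (x t)) - (p - 1) * x t * (\<eta> - g (x t))) - C * exp (- \<kappa> * t)" for t
  have U_deriv: "(U has_real_derivative U' t) (at t)" if t: "T' \<le> t" for t
  proof -
    have tT: "T \<le> t"
      using t z by simp
    have B': "((\<lambda>t. B (x t)) has_real_derivative
        f (x t) * (s t * (\<alpha> + e t - g (x t)) - (p - 1) * x t * (\<eta> - g (x t)))) (at t)"
      using DERIV_chain2[OF B_deriv x_deriv'[OF tT]] R tT by simp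
    have ln': "((\<lambda>t. ln (s t)) has_real_derivative (2 - p) * (\<delta> - g (x t))) (at t)"
      using s_pos[OF tT] by (auto intro!: derivative_eq_intros s_deriv[OF tT])
    have S': "((\<lambda>t. (s t - s\<^sub>0 * ln (s t)) / (2 - p)) has_real_derivative
        (s t - s\<^sub>0) * (\<delta> - g (x t))) (at t)"
    proof -
      have "((2 - p) * s t * (\<delta> - g (x t)) - s\<^sub>0 * ((2 - p) * (\<delta> - g (x t)))) / (2 - p)
          = (2 - p) * ((s t - s\<^sub>0) * (\<delta> - g (x t))) / (2 - p)"
        by (simp add: algebra_simps)
      also have "\<dots> = (s t - s\<^sub>0) * (\<delta> - g (x t))"
        using p by simp
      finally show ?thesis
        using DERIV_cdivide[OF DERIV_diff[OF s_deriv[OF tT] DERIV_cmult[OF ln', of s\<^sub>0]], of "2 - p"]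
        by simp
    qed
    have E': "((\<lambda>t. C / \<kappa> * exp (- \<kappa> * t)) has_real_derivative - (C * exp (- \<kappa> * t))) (at t)"
      using \<kappa> by (auto intro!: derivative_eq_intros)
    show ?thesis
      unfolding U_def U'_def using DERIV_add[OF DERIV_add[OF S' B'] E'] by simp
  qed
  have U'_le: "U' t \<le> - ((p - 1) * ((g (x t) - \<delta>) * (x t - x\<^sub>0)))" if t: "T' \<le> t" for t
  proof -
    have tT: "T \<le> t"
      using t z by simp
    have gx: "g (x t) \<le> g z"
      using z t by (simp add: g_le_iff)
    then have lt: "g (x t) < \<alpha>"
      using z by simp
    have f: "f (x t) = (g (x t) - \<delta>) / (\<alpha> - g (x t))"
      using z t by (simp add: f_def min_absorb1)
    have f_le: "f (x t) \<le> \<alpha> / (\<alpha> - g z)"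
      unfolding f using gx lt z exps by (intro frac_le) auto
    have "f (x t) * (s t * e t) \<le> \<alpha> / (\<alpha> - g z) * (S * (E * exp (- \<kappa> * t)))"
      using f_le S[of] E tT s_pos[OF tT] e_nonneg z exps by (intro mult_mono mult_nonneg_nonneg) auto
    then have small: "f (x t) * (s t * e t) \<le> C * exp (- \<kappa> * t)"
      by (simp add: C_def mult.assoc)
    \<comment> \<open>Since \<open>f (x t) * (\<alpha> - g (x t)) = g (x t) - \<delta>\<close>, the
      terms proportional to \<open>s t\<close> cancel, apart from the perturbation.\<close>
    have "U' t = - ((g (x t) - \<delta>) * ((p - 1) * x t * (\<eta> - g (x t)) / (\<alpha> - g (x t)) - s\<^sub>0))
        + f (x t) * (s t * e t) - C * exp (- \<kappa> * t)"
    proof -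
      have "f (x t) * (s t * (\<alpha> + e t - g (x t)) - (p - 1) * x t * (\<eta> - g (x t)))
          = s t * (f (x t) * (\<alpha> - g (x t))) + f (x t) * (s t * e t)
            - f (x t) * ((p - 1) * x t * (\<eta> - g (x t)))"
        by (simp add: algebra_simps)
      also have "f (x t) * (\<alpha> - g (x t)) = g (x t) - \<delta>"
        using lt by (simp add: f)
      also have "f (x t) * ((p - 1) * x t * (\<eta> - g (x t)))
          = (g (x t) - \<delta>) * ((p - 1) * x t * (\<eta> - g (x t)) / (\<alpha> - g (x t)))"
        by (simp add: f)
      finally show ?thesis
        unfolding U'_def by (simp add: algebra_simps)
    qed
    also have "\<dots> \<le> - ((p - 1) * ((g (x t) - \<delta>) * (x t - x\<^sub>0)))"
      using h_minus_s\<^sub>0[OF lt] small by linarith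
    finally show ?thesis .
  qed
  have U'_nonpos: "U' t \<le> 0" if "T' \<le> t" for t
  proof -
    have "0 \<le> (g (x t) - \<delta>) * (x t - x\<^sub>0)"
      using g_le_iff[of "x t" x\<^sub>0] g_le_iff[of x\<^sub>0 "x t"] by (auto simp: g_x\<^sub>0 zero_le_mult_iff)
    then show ?thesis
      using U'_le[OF that] p by (smt (verit) mult_nonneg_nonneg)
  qed
  have U_ge: "(s\<^sub>0 - s\<^sub>0 * ln s\<^sub>0) / (2 - p) - b \<le> U t" if "T' \<le> t" for t
  proof -
    have tT: "T \<le> t"
      using that z by simp
    \<comment> \<open>The function \<open>s - s\<^sub>0 * ln s\<close> is minimal at
      \<open>s = s\<^sub>0\<close>.\<close>
    have "ln (s t / s\<^sub>0) \<le> s t / s\<^sub>0 - 1"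
      using s_pos[OF tT] s\<^sub>0_pos by (intro ln_le_minus_one) auto
    then have "s\<^sub>0 * ln (s t / s\<^sub>0) \<le> s\<^sub>0 * (s t / s\<^sub>0 - 1)"
      using s\<^sub>0_pos by (intro mult_left_mono) auto
    then have "s\<^sub>0 - s\<^sub>0 * ln s\<^sub>0 \<le> s t - s\<^sub>0 * ln (s t)"
      using s\<^sub>0_pos s_pos[OF tT] by (simp add: ln_div algebra_simps)
    then have "(s\<^sub>0 - s\<^sub>0 * ln s\<^sub>0) / (2 - p) \<le> (s t - s\<^sub>0 * ln (s t)) / (2 - p)"
      using p by (intro divide_right_mono) auto
    moreover have "0 \<le> C / \<kappa> * exp (- \<kappa> * t)"
      using \<open>0 < C\<close> \<kappa> by simp
    ultimately show ?thesis
      unfolding U_def using b[OF R(2)[OF tT]] by linarith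
  qed
  obtain L where "(U \<longlongrightarrow> L) at_top"
    by (rule nonincreasing_bounded_tendsto[OF U_deriv U'_nonpos U_ge])
  with z(1) U_deriv U'_le show ?thesis
    by (intro exI[of _ U] exI[of _ U'] exI[of _ L] exI[of _ T']) simp
qed

section \<open>Convergence to the equilibrium\<close>

lemma x'_bounded:
  obtains K where "\<And>t. T \<le> t \<Longrightarrow> \<bar>s t * (\<alpha> + e t - g (x t)) - (p - 1) * x t * (\<eta> - g (x t))\<bar> \<le> K"
    "\<And>t. T \<le> t \<Longrightarrow> \<bar>(2 - p) * s t * (\<delta> - g (x t))\<bar> \<le> K"
proof -
  obtain S where S: "0 < S" "\<And>t. T \<le> t \<Longrightarrow> s t \<le> S"
    using s_bounded by blast
  obtain E where E: "0 < E" "\<And>t. T \<le> t \<Longrightarrow> e t \<le> E * exp (- \<kappa> * t)"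
    using e_bounded by blast
  obtain R where R: "0 < R" "\<And>t. T \<le> t \<Longrightarrow> \<bar>x t\<bar> \<le> R"
    using x_bounded by blast
  define M where "M = \<eta> + E * exp (- \<kappa> * T) + g R"
  have gR: "\<bar>g (x t)\<bar> \<le> g R" if "T \<le> t" for t
    using R(2)[OF that] g_le_iff[of "x t" R] g_le_iff[of "- R" "x t"] by (auto simp: abs_le_iff)
  have e: "e t \<le> E * exp (- \<kappa> * T)" if "T \<le> t" for t
  proof -
    have "E * exp (- \<kappa> * t) \<le> E * exp (- \<kappa> * T)"
      using that E \<kappa> by simp
    then show ?thesis
      using E(2)[OF that] by simp
  qed
  have pos: "0 < E * exp (- \<kappa> * T)"
    using E by simp
  show thesis
  proof (rule that[of "S * M + (p - 1) * R * M + (2 - p) * S * M"])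
    fix t assume t: "T \<le> t"
    have M: "\<bar>\<alpha> + e t - g (x t)\<bar> \<le> M" "\<bar>\<eta> - g (x t)\<bar> \<le> M" "\<bar>\<delta> - g (x t)\<bar> \<le> M" "0 \<le> M"
      using gR[OF t] e[OF t] e_nonneg[of t] exps pos by (auto simp: M_def abs_le_iff)
    have 1: "\<bar>s t * (\<alpha> + e t - g (x t))\<bar> \<le> S * M"
      unfolding abs_mult using S t s_pos[OF t] M by (intro mult_mono) auto
    have 2: "\<bar>(p - 1) * x t * (\<eta> - g (x t))\<bar> \<le> (p - 1) * R * M"
      unfolding abs_mult using p R t M by (intro mult_mono) auto
    have 3: "\<bar>(2 - p) * s t * (\<delta> - g (x t))\<bar> \<le> (2 - p) * S * M"
      unfolding abs_mult using p S t s_pos[OF t] M by (intro mult_mono) auto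
    have "0 \<le> S * M" "0 \<le> (p - 1) * R * M" "0 \<le> (2 - p) * S * M"
      using p S R M by auto
    then show "\<bar>s t * (\<alpha> + e t - g (x t)) - (p - 1) * x t * (\<eta> - g (x t))\<bar>
        \<le> S * M + (p - 1) * R * M + (2 - p) * S * M"
      and "\<bar>(2 - p) * s t * (\<delta> - g (x t))\<bar> \<le> S * M + (p - 1) * R * M + (2 - p) * S * M"
      using 1 2 3 by linarith+
  qed
qed

text \<open>While \<open>x\<close> is at distance at least \<open>d / 2\<close> from
  \<open>x\<^sub>0\<close> on one side, strict monotonicity of \<open>g\<close> makes the Lyapunov
  function drop at a fixed rate. So \<open>barbalat\<close> applies to \<open>x - x\<^sub>0\<close>
  and to \<open>x\<^sub>0 - x\<close>.\<close>

lemma x_tendsto: "(x \<longlongrightarrow> x\<^sub>0) at_top"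
proof -
  obtain U U' L T' where U: "T \<le> T'" "(U \<longlongrightarrow> L) at_top"
    "\<And>t. T' \<le> t \<Longrightarrow> (U has_real_derivative U' t) (at t)"
    "\<And>t. T' \<le> t \<Longrightarrow> U' t \<le> - ((p - 1) * ((g (x t) - \<delta>) * (x t - x\<^sub>0)))"
    using lyapunov by blast
  obtain K where K: "\<And>t. T \<le> t \<Longrightarrow> \<bar>s t * (\<alpha> + e t - g (x t)) - (p - 1) * x t * (\<eta> - g (x t))\<bar> \<le> K"
    using x'_bounded by metis
  have upper: "\<forall>\<^sub>F t in at_top. x t - x\<^sub>0 < d" if "0 < d" for d
  proof (rule barbalat[OF U(2) U(3)])
    let ?c = "(p - 1) * ((g (x\<^sub>0 + d / 2) - \<delta>) * (d / 2))"
    have gd: "\<delta> < g (x\<^sub>0 + d / 2)"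
      using that g_less_iff[of x\<^sub>0 "x\<^sub>0 + d / 2"] by (simp add: g_x\<^sub>0)
    then show "0 < ?c"
      using p that by simp
    fix t assume t: "T' \<le> t"
    then have tT: "T \<le> t"
      using U by simp
    show "((\<lambda>t. x t - x\<^sub>0) has_real_derivative
        s t * (\<alpha> + e t - g (x t)) - (p - 1) * x t * (\<eta> - g (x t))) (at t)"
      using DERIV_diff[OF x_deriv'[OF tT] DERIV_const] by simp
    show "- K \<le> s t * (\<alpha> + e t - g (x t)) - (p - 1) * x t * (\<eta> - g (x t))"
      using K[OF tT] by linarith
    assume "d / 2 \<le> x t - x\<^sub>0"
    then have "?c \<le> (p - 1) * ((g (x t) - \<delta>) * (x t - x\<^sub>0))"
      using p gd that g_le_iff[of "x\<^sub>0 + d / 2" "x t"] by (intro mult_left_mono mult_mono) auto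
    then show "U' t \<le> - ?c"
      using U(4)[OF t] by linarith
  qed (use that in auto)
  have lower: "\<forall>\<^sub>F t in at_top. x\<^sub>0 - x t < d" if "0 < d" for d
  proof (rule barbalat[OF U(2) U(3)])
    let ?c = "(p - 1) * ((\<delta> - g (x\<^sub>0 - d / 2)) * (d / 2))"
    have gd: "g (x\<^sub>0 - d / 2) < \<delta>"
      using that g_less_iff[of "x\<^sub>0 - d / 2" x\<^sub>0] by (simp add: g_x\<^sub>0)
    then show "0 < ?c"
      using p that by simp
    fix t assume t: "T' \<le> t"
    then have tT: "T \<le> t"
      using U by simp
    show "((\<lambda>t. x\<^sub>0 - x t) has_real_derivative
        - (s t * (\<alpha> + e t - g (x t)) - (p - 1) * x t * (\<eta> - g (x t)))) (at t)"
      using DERIV_diff[OF DERIV_const x_deriv'[OF tT]] by simp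
    show "- K \<le> - (s t * (\<alpha> + e t - g (x t)) - (p - 1) * x t * (\<eta> - g (x t)))"
      using K[OF tT] by linarith
    assume "d / 2 \<le> x\<^sub>0 - x t"
    then have "?c \<le> (p - 1) * ((\<delta> - g (x t)) * (x\<^sub>0 - x t))"
      using p gd that g_le_iff[of "x t" "x\<^sub>0 - d / 2"] by (intro mult_left_mono mult_mono) auto
    also have "\<dots> = (p - 1) * ((g (x t) - \<delta>) * (x t - x\<^sub>0))"
      by (simp add: algebra_simps)
    finally show "U' t \<le> - ?c"
      using U(4)[OF t] by linarith
  qed (use that in auto)
  show ?thesis
    unfolding tendsto_iff
  proof (intro allI impI)
    fix d :: real assume "0 < d"
    then show "\<forall>\<^sub>F t in at_top. dist (x t) x\<^sub>0 < d"
      using eventually_conj[OF upper lower, of d d]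
      by (auto elim!: eventually_mono simp: dist_real_def)
  qed
qed

text \<open>The roles shift in \<open>barbalat\<close>: the convergent function is now
  \<open>x\<close> or \<open>- x\<close>, and \<open>s\<close> is the observed quantity. As
  \<open>x\<close> settles, \<open>s\<close> away from \<open>s\<^sub>0\<close> would give
  \<open>x\<close> a derivative bounded away from 0.\<close>

lemma s_tendsto: "(s \<longlongrightarrow> s\<^sub>0) at_top"
proof -
  obtain K where K: "\<And>t. T \<le> t \<Longrightarrow> \<bar>(2 - p) * s t * (\<delta> - g (x t))\<bar> \<le> K"
    using x'_bounded by metis
  have "continuous (at x\<^sub>0) g"
    using continuous_on_g[of UNIV "\<lambda>u. u"] by (simp add: continuous_on_eq_continuous_at)
  then have g_lim: "((\<lambda>t. g (x t)) \<longlongrightarrow> \<delta>) at_top"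
    using isCont_tendsto_compose[OF _ x_tendsto, of g] by (simp add: g_x\<^sub>0)
  \<comment> \<open>\<open>r\<close> is the derivative of \<open>x\<close> with \<open>s t\<close>
    replaced by \<open>s\<^sub>0\<close>; it vanishes in the limit by the choice of
    \<open>s\<^sub>0\<close>.\<close>
  define r where "r t = s\<^sub>0 * (\<alpha> + e t - g (x t)) - (p - 1) * x t * (\<eta> - g (x t))" for t
  have "(r \<longlongrightarrow> s\<^sub>0 * (\<alpha> + 0 - \<delta>) - (p - 1) * x\<^sub>0 * (\<eta> - \<delta>)) at_top"
    unfolding r_def by (intro tendsto_intros x_tendsto g_lim e_tendsto)
  then have r_lim: "(r \<longlongrightarrow> 0) at_top"
    using exps by (simp add: s\<^sub>0_def)
  have coeff: "((\<lambda>t. \<alpha> + e t - g (x t)) \<longlongrightarrow> \<alpha> + 0 - \<delta>) at_top"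
    by (intro tendsto_intros g_lim e_tendsto)
  have x': "s t * (\<alpha> + e t - g (x t)) - (p - 1) * x t * (\<eta> - g (x t))
      = (s t - s\<^sub>0) * (\<alpha> + e t - g (x t)) + r t" for t
    by (simp add: r_def algebra_simps)
  \<comment> \<open>If \<open>s\<close> is off by \<open>d / 2\<close>, the main term has size at
    least \<open>d * (\<alpha> - \<delta>) / 4\<close>; an error of half that size still leaves the
    rate \<open>d * (\<alpha> - \<delta>) / 8\<close>.\<close>
  have ev: "\<exists>T'\<ge>T. \<forall>t\<ge>T'. \<bar>r t\<bar> < d * (\<alpha> - \<delta>) / 8 \<and> (\<alpha> - \<delta>) / 2 < \<alpha> + e t - g (x t)"
    if "0 < d" for d
  proof -
    have "0 < d * (\<alpha> - \<delta>) / 8"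
      using that exps by simp
    then have "\<forall>\<^sub>F t in at_top. \<bar>r t\<bar> < d * (\<alpha> - \<delta>) / 8"
      using r_lim unfolding tendsto_iff by (simp only: dist_real_def diff_0_right)
    moreover have "\<forall>\<^sub>F t in at_top. (\<alpha> - \<delta>) / 2 < \<alpha> + e t - g (x t)"
      using exps by (intro order_tendstoD(1)[OF coeff]) auto
    ultimately have "\<forall>\<^sub>F t in at_top. \<bar>r t\<bar> < d * (\<alpha> - \<delta>) / 8 \<and> (\<alpha> - \<delta>) / 2 < \<alpha> + e t - g (x t)"
      by (rule eventually_conj)
    then obtain T1 where "\<forall>t\<ge>T1. \<bar>r t\<bar> < d * (\<alpha> - \<delta>) / 8 \<and> (\<alpha> - \<delta>) / 2 < \<alpha> + e t - g (x t)"
      unfolding eventually_at_top_linorder by blast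
    then show ?thesis
      by (intro exI[of _ "max T T1"]) auto
  qed
  have upper: "\<forall>\<^sub>F t in at_top. s t - s\<^sub>0 < d" if d: "0 < d" for d
  proof -
    obtain T' where T': "T \<le> T'" "\<And>t. T' \<le> t \<Longrightarrow> \<bar>r t\<bar> < d * (\<alpha> - \<delta>) / 8"
      "\<And>t. T' \<le> t \<Longrightarrow> (\<alpha> - \<delta>) / 2 < \<alpha> + e t - g (x t)"
      using ev[OF d] by blast
    show ?thesis
    proof (rule barbalat[OF tendsto_minus[OF x_tendsto] DERIV_minus[OF x_deriv']])
      fix t assume t: "T' \<le> t"
      then have tT: "T \<le> t"
        using T' by simp
      then show "T \<le> t" .
      show "((\<lambda>t. s t - s\<^sub>0) has_real_derivative (2 - p) * s t * (\<delta> - g (x t))) (at t)"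
        using DERIV_diff[OF s_deriv[OF tT] DERIV_const] by simp
      show "- K \<le> (2 - p) * s t * (\<delta> - g (x t))"
        using K[OF tT] by linarith
      assume "d / 2 \<le> s t - s\<^sub>0"
      then have "d / 2 * ((\<alpha> - \<delta>) / 2) \<le> (s t - s\<^sub>0) * (\<alpha> + e t - g (x t))"
        using T'(3)[OF t] d exps by (intro mult_mono) auto
      then show "- (s t * (\<alpha> + e t - g (x t)) - (p - 1) * x t * (\<eta> - g (x t)))
          \<le> - (d * (\<alpha> - \<delta>) / 8)"
        unfolding x' using T'(2)[OF t] by (simp add: abs_less_iff)
    qed (use d exps in auto)
  qed
  have lower: "\<forall>\<^sub>F t in at_top. s\<^sub>0 - s t < d" if d: "0 < d" for d
  proof -
    obtain T' where T': "T \<le> T'" "\<And>t. T' \<le> t \<Longrightarrow> \<bar>r t\<bar> < d * (\<alpha> - \<delta>) / 8"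
      "\<And>t. T' \<le> t \<Longrightarrow> (\<alpha> - \<delta>) / 2 < \<alpha> + e t - g (x t)"
      using ev[OF d] by blast
    show ?thesis
    proof (rule barbalat[OF x_tendsto x_deriv'])
      fix t assume t: "T' \<le> t"
      then have tT: "T \<le> t"
        using T' by simp
      then show "T \<le> t" .
      show "((\<lambda>t. s\<^sub>0 - s t) has_real_derivative - ((2 - p) * s t * (\<delta> - g (x t)))) (at t)"
        using DERIV_diff[OF DERIV_const s_deriv[OF tT]] by simp
      show "- K \<le> - ((2 - p) * s t * (\<delta> - g (x t)))"
        using K[OF tT] by linarith
      assume "d / 2 \<le> s\<^sub>0 - s t"
      then have "d / 2 * ((\<alpha> - \<delta>) / 2) \<le> (s\<^sub>0 - s t) * (\<alpha> + e t - g (x t))"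
        using T'(3)[OF t] d exps by (intro mult_mono) auto
      also have "\<dots> = - ((s t - s\<^sub>0) * (\<alpha> + e t - g (x t)))"
        by (simp add: algebra_simps)
      finally show "s t * (\<alpha> + e t - g (x t)) - (p - 1) * x t * (\<eta> - g (x t)) \<le> - (d * (\<alpha> - \<delta>) / 8)"
        unfolding x' using T'(2)[OF t] by (simp add: abs_less_iff)
    qed (use d exps in auto)
  qed
  show ?thesis
    unfolding tendsto_iff
  proof (intro allI impI)
    fix d :: real assume "0 < d"
    then show "\<forall>\<^sub>F t in at_top. dist (s t) s\<^sub>0 < d"
      using eventually_conj[OF upper lower, of d d]
      by (auto elim!: eventually_mono simp: dist_real_def)
  qed
qed

lemma y_tendsto: "(y \<longlongrightarrow> s\<^sub>0 powr (1 / (2 - p))) at_top"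
proof -
  have "((\<lambda>t. s t powr (1 / (2 - p))) \<longlongrightarrow> s\<^sub>0 powr (1 / (2 - p))) at_top"
    using s\<^sub>0_pos by (intro tendsto_powr s_tendsto) auto
  moreover have "\<forall>\<^sub>F t in at_top. s t powr (1 / (2 - p)) = y t"
    unfolding eventually_at_top_linorder using p y_pos
    by (intro exI[of _ T]) (auto simp: s_def powr_powr less_imp_le)
  ultimately show ?thesis
    by (rule Lim_transform_eventually)
qed

end

section \<open>Energy and decay\<close>

text \<open>\<open>v\<close> is \<open>w'\<close> and \<open>F\<close> is the flux. Their relation
  is solved for \<open>v\<close>, because the exponent \<open>(2 - p) / (p - 1)\<close> is positive
  while \<open>p - 2\<close> is negative.\<close>

locale radial_solution =
  fixes n p q \<alpha> :: real and w v F F' :: "real \<Rightarrow> real"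
  assumes n: "1 \<le> n" and p: "1 < p" "p < 2" and q: "1 < q" and \<alpha>: "0 < \<alpha>"
    and w_deriv: "\<And>r. 0 \<le> r \<Longrightarrow> (w has_real_derivative v r) (at r within {0..})"
    and F_deriv: "\<And>r. 0 \<le> r \<Longrightarrow> (F has_real_derivative F' r) (at r within {0..})"
    and v_eq: "\<And>r. 0 \<le> r \<Longrightarrow> v r = signed_powr ((2 - p) / (p - 1)) (F r)"
    and ode: "\<And>r. 0 < r \<Longrightarrow>
      F' r + (n - 1) / r * F r + r * v r + \<alpha> * w r + signed_powr (q - 1) (w r) = 0"
    and w_0: "w 0 \<noteq> 0"
begin

text \<open>The equation is odd. Interpreting the locale at \<open>- w\<close> transfers results on
  positive phases to negative ones.\<close>

lemma uminus: "radial_solution n p q \<alpha> (\<lambda>r. - w r) (\<lambda>r. - v r) (\<lambda>r. - F r) (\<lambda>r. - F' r)"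
proof
  fix r :: real assume "0 \<le> r"
  then show "((\<lambda>r. - w r) has_real_derivative - v r) (at r within {0..})"
    by (intro DERIV_minus w_deriv)
next
  fix r :: real assume "0 < r"
  then show "- F' r + (n - 1) / r * - F r + r * - v r + \<alpha> * - w r + signed_powr (q - 1) (- w r) = 0"
    using ode[of r] by simp
qed (use n p q \<alpha> w_0 v_eq in \<open>auto intro: DERIV_minus F_deriv\<close>)

lemma at_within_halfline: "0 < r \<Longrightarrow> at r within {0..} = at (r :: real)"
  by (rule at_within_interior) (simp add: interior_real_atLeast)

lemma w_deriv_at: "0 < r \<Longrightarrow> (w has_real_derivative v r) (at r)"
  using w_deriv[of r] by (simp add: at_within_halfline)

lemma F_deriv_at: "0 < r \<Longrightarrow> (F has_real_derivative F' r) (at r)"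
  using F_deriv[of r] by (simp add: at_within_halfline)

lemma continuous_w: "continuous_on {0..} w"
  using w_deriv by (intro DERIV_continuous_on) auto

lemma continuous_F: "continuous_on {0..} F"
  using F_deriv by (intro DERIV_continuous_on) auto

text \<open>The first summand is \<open>(p - 1) / p * \<bar>w'\<bar> powr p\<close>, written through
  the flux because the flux is what is assumed differentiable.\<close>

definition E :: "real \<Rightarrow> real" where
  "E r = (p - 1) / p * \<bar>F r\<bar> powr (p / (p - 1)) + \<alpha> / 2 * (w r)\<^sup>2 + \<bar>w r\<bar> powr (q + 1) / (q + 1)"

lemma exponent: "-1 < (2 - p) / (p - 1)" "0 < (2 - p) / (p - 1)" "(2 - p) / (p - 1) + 1 = 1 / (p - 1)"
    "p / (p - 1) - 2 = (2 - p) / (p - 1)" "1 < p / (p - 1)"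
  using p by (auto simp: field_simps)

lemma vF: "0 \<le> r \<Longrightarrow> v r * F r = \<bar>F r\<bar> powr (p / (p - 1))"
proof -
  assume "0 \<le> r"
  have "\<bar>a\<bar> powr (p / (p - 1) - 2) * a * a = \<bar>a\<bar> powr (p / (p - 1))" for a :: real
    by (cases "a = 0") (simp_all add: powr_diff power2_eq_square)
  then show ?thesis
    using v_eq[OF \<open>0 \<le> r\<close>] by (simp only: signed_powr_def exponent)
qed

text \<open>Multiply the equation by \<open>w'\<close>: the damping terms are what remains.\<close>

lemma E_deriv:
  assumes "0 < r"
  shows "(E has_real_derivative - (v r * ((n - 1) / r * F r + r * v r))) (at r)"
proof -
  have "((\<lambda>r. \<bar>F r\<bar> powr (p / (p - 1))) has_real_derivative
      p / (p - 1) * signed_powr (p / (p - 1) - 2) (F r) * F' r) (at r)"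
    using exponent by (intro DERIV_chain2[OF DERIV_abs_powr F_deriv_at[OF assms]]) auto
  then have 1: "((\<lambda>r. \<bar>F r\<bar> powr (p / (p - 1))) has_real_derivative p / (p - 1) * v r * F' r) (at r)"
    using v_eq[of r] assms by (simp add: exponent)
  have "((\<lambda>r. \<bar>w r\<bar> powr (q + 1)) has_real_derivative
      (q + 1) * signed_powr (q + 1 - 2) (w r) * v r) (at r)"
    using q by (intro DERIV_chain2[OF DERIV_abs_powr w_deriv_at[OF assms]]) auto
  then have 2: "((\<lambda>r. \<bar>w r\<bar> powr (q + 1)) has_real_derivative
      (q + 1) * signed_powr (q - 1) (w r) * v r) (at r)"
    by simp
  have 3: "((\<lambda>r. (w r)\<^sup>2) has_real_derivative 2 * w r * v r) (at r)"
    using w_deriv_at[OF assms] by (auto intro!: derivative_eq_intros)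
  have "(p - 1) / p * (p / (p - 1) * v r * F' r) + \<alpha> / 2 * (2 * w r * v r)
      + (q + 1) * signed_powr (q - 1) (w r) * v r / (q + 1)
      = v r * F' r + \<alpha> * w r * v r + signed_powr (q - 1) (w r) * v r"
    using p q by simp
  also have "\<dots> = v r * (F' r + \<alpha> * w r + signed_powr (q - 1) (w r))"
    by (simp add: algebra_simps)
  also have "F' r + \<alpha> * w r + signed_powr (q - 1) (w r) = - ((n - 1) / r * F r + r * v r)"
    using ode[OF assms] by simp
  finally show ?thesis
    using DERIV_add[OF DERIV_add[OF DERIV_cmult[OF 1, of "(p - 1) / p"] DERIV_cmult[OF 3, of "\<alpha> / 2"]]
        DERIV_cdivide[OF 2, of "q + 1"]]
    unfolding E_def[abs_def] by (simp only: mult_minus_right)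
qed

lemma continuous_E: "continuous_on {0..} E"
proof -
  have abs_powr: "continuous_on {0..} (\<lambda>r. \<bar>f r\<bar> powr b)"
    if "continuous_on {0..} f" "1 < b" for f :: "real \<Rightarrow> real" and b
    by (rule continuous_on_compose2[OF DERIV_continuous_on[OF DERIV_abs_powr[OF that(2)]] that(1)])
      simp
  show ?thesis
    unfolding E_def[abs_def] divide_inverse[of "\<bar>w _\<bar> powr _"] using exponent q
    by (intro continuous_on_add continuous_on_mult continuous_on_power continuous_on_const abs_powr
        continuous_w continuous_F) auto
qed

lemma E_le:
  assumes "0 \<le> r"
  shows "E r \<le> E 0"
proof (cases "r = 0")
  case False
  show ?thesis
  proof (rule DERIV_nonpos_imp_decreasing_open[of 0 r])
    show "continuous_on {0..r} E"
      by (rule continuous_on_subset[OF continuous_E]) auto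
    fix u assume u: "0 < u" "u < r"
    have "v u * ((n - 1) / u * F u + u * v u) = (n - 1) / u * (v u * F u) + u * (v u)\<^sup>2"
      by (simp add: algebra_simps power2_eq_square)
    also have "\<dots> \<ge> 0"
    proof (intro add_nonneg_nonneg mult_nonneg_nonneg[of _ "v u * F u"] mult_nonneg_nonneg[of u])
      show "0 \<le> v u * F u"
        using vF[of u] u by simp
    qed (use u n in auto)
    finally show "\<exists>y. (E has_real_derivative y) (at u) \<and> y \<le> 0"
      using E_deriv[OF u(1)] by (intro exI conjI) auto
  qed (use assms False in auto)
qed simp

section \<open>Consequences of the energy: bounded flux and simple zeros\<close>

lemma F_bounded:
  obtains M where "0 < M" "\<And>r. 0 \<le> r \<Longrightarrow> \<bar>F r\<bar> \<le> M"
proof -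
  have "\<bar>F r\<bar> \<le> (E 0 * p / (p - 1)) powr ((p - 1) / p)" if "0 \<le> r" for r
  proof -
    have "(p - 1) / p * \<bar>F r\<bar> powr (p / (p - 1)) \<le> E r"
      unfolding E_def using q \<alpha> by (simp add: add_nonneg_nonneg)
    also have "\<dots> \<le> E 0"
      using that by (rule E_le)
    finally have "\<bar>F r\<bar> powr (p / (p - 1)) \<le> E 0 * p / (p - 1)"
      using p by (simp add: field_simps)
    then have "(\<bar>F r\<bar> powr (p / (p - 1))) powr ((p - 1) / p) \<le> (E 0 * p / (p - 1)) powr ((p - 1) / p)"
      using p by (intro powr_mono2) auto
    then show ?thesis
      using p by (simp add: powr_powr)
  qed
  then have "\<bar>F r\<bar> \<le> (E 0 * p / (p - 1)) powr ((p - 1) / p) + 1" if "0 \<le> r" for r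
    using that by force
  moreover have "0 < (E 0 * p / (p - 1)) powr ((p - 1) / p) + 1"
    by (simp add: add_nonneg_pos)
  ultimately show thesis
    using that by blast
qed

text \<open>A Gronwall argument. Since \<open>p < 2\<close> and \<open>F\<close> is bounded,
  \<open>(v r)\<^sup>2\<close> is at most a constant times \<open>v r * F r\<close>, which is
  controlled by \<open>E r\<close>. Hence the dissipation is at most \<open>K * E r\<close>, and
  \<open>E r * exp (K * r)\<close> is nondecreasing.\<close>

lemma E_pos:
  assumes "0 \<le> R"
  shows "0 < E R"
proof (rule ccontr)
  assume not_pos: "\<not> 0 < E R"
  have "0 < \<alpha> / 2 * (w 0)\<^sup>2"
    using \<alpha> w_0 by simp
  also have "\<dots> \<le> E 0"
    unfolding E_def using p q by simp
  finally have "0 < E 0" .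
  moreover have "continuous_on {0..R} E"
    by (rule continuous_on_subset[OF continuous_E]) auto
  \<comment> \<open>The coefficient \<open>(n - 1) / r\<close> is singular at 0, so the comparison
    starts at a positive radius where the energy is still known to be positive.\<close>
  ultimately obtain s where s: "0 < s" "s \<le> R" "E s = E 0 / 2"
    using first_hit[of 0 R E "E 0 / 2"] assms not_pos by auto
  obtain M where M: "0 < M" "\<And>r. 0 \<le> r \<Longrightarrow> \<bar>F r\<bar> \<le> M"
    using F_bounded by blast
  define K where "K = ((n - 1) / s + R * M powr ((2 - p) / (p - 1))) * (p / (p - 1))"
  have "E s * exp (K * s) \<le> E R * exp (K * R)"
  proof (rule DERIV_nonneg_imp_nondecreasing[OF s(2)])
    fix r assume r: "s \<le> r" "r \<le> R"
    then have "0 < r"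
      using s by simp
    have "(v r)\<^sup>2 = \<bar>v r\<bar> * \<bar>v r\<bar>"
      by (simp add: power2_eq_square)
    also have "\<dots> = \<bar>F r\<bar> powr ((2 - p) / (p - 1)) * \<bar>v r * F r\<bar>"
      using v_eq[of r] \<open>0 < r\<close> by (simp add: signed_powr_def abs_mult)
    also have "\<dots> = \<bar>F r\<bar> powr ((2 - p) / (p - 1)) * (v r * F r)"
      using vF[of r] \<open>0 < r\<close> by simp
    also have "\<dots> \<le> M powr ((2 - p) / (p - 1)) * (v r * F r)"
      using M \<open>0 < r\<close> p vF[of r] by (intro mult_right_mono powr_mono2) auto
    finally have v2: "(v r)\<^sup>2 \<le> M powr ((2 - p) / (p - 1)) * (v r * F r)" .
    have "v r * ((n - 1) / r * F r + r * v r) = (n - 1) / r * (v r * F r) + r * (v r)\<^sup>2"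
      by (simp add: algebra_simps power2_eq_square)
    also have "\<dots> \<le> (n - 1) / s * (v r * F r) + R * (M powr ((2 - p) / (p - 1)) * (v r * F r))"
      using v2 r s n vF[of r] \<open>0 < r\<close>
      by (intro add_mono mult_mono mult_right_mono divide_left_mono) auto
    also have "\<dots> = ((n - 1) / s + R * M powr ((2 - p) / (p - 1))) * (v r * F r)"
      by (simp add: algebra_simps)
    also have "v r * F r \<le> p / (p - 1) * E r"
    proof -
      have "(p - 1) / p * (v r * F r) \<le> E r"
        unfolding E_def using q \<alpha> vF[of r] \<open>0 < r\<close> by (simp add: add_nonneg_nonneg)
      then show ?thesis
        using p by (simp add: field_simps)
    qed
    then have "((n - 1) / s + R * M powr ((2 - p) / (p - 1))) * (v r * F r)
        \<le> ((n - 1) / s + R * M powr ((2 - p) / (p - 1))) * (p / (p - 1) * E r)"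
      using n s assms by (intro mult_left_mono add_nonneg_nonneg mult_nonneg_nonneg) auto
    also have "\<dots> = K * E r"
      by (simp add: K_def)
    finally have "0 \<le> (- (v r * ((n - 1) / r * F r + r * v r)) + K * E r) * exp (K * r)"
      by (intro mult_nonneg_nonneg) auto
    moreover have "((\<lambda>r. E r * exp (K * r)) has_real_derivative
        (- (v r * ((n - 1) / r * F r + r * v r)) + K * E r) * exp (K * r)) (at r)"
      using E_deriv[OF \<open>0 < r\<close>] by (auto intro!: derivative_eq_intros simp: algebra_simps)
    ultimately show "\<exists>y. ((\<lambda>r. E r * exp (K * r)) has_real_derivative y) (at r) \<and> 0 \<le> y"
      by blast
  qed
  also have "\<dots> \<le> 0"
    using not_pos by (simp add: mult_le_0_iff)
  finally show False
    using s \<open>0 < E 0\<close> by (simp add: mult_le_0_iff)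
qed

text \<open>An accumulation point of zeros is itself a zero, and positive energy gives
  \<open>w' \<noteq> 0\<close> there, so nearby points cannot be zeros.\<close>

lemma finite_zeros_compact: "finite {r \<in> {0..R}. w r = 0}"
proof (rule ccontr)
  define Z where "Z = {r \<in> {0..R}. w r = 0}"
  assume "infinite {r \<in> {0..R}. w r = 0}"
  then have "infinite Z" "Z \<subseteq> {0..R}"
    by (auto simp: Z_def)
  then have "\<exists>z\<in>{0..R}. z islimpt Z"
    using Heine_Borel_imp_Bolzano_Weierstrass[of "{0..R}" Z] by simp
  then obtain z where z: "z \<in> {0..R}" "z islimpt Z"
    by blast
  have "closed ({0..R} \<inter> w -` {0})"
    by (intro continuous_closed_preimage continuous_on_subset[OF continuous_w]) auto
  moreover have "{0..R} \<inter> w -` {0} = Z"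
    by (auto simp: Z_def)
  ultimately have "z \<in> Z"
    using z closed_limpt by auto
  then have "w z = 0" "0 < z"
    using w_0 by (auto simp: Z_def less_le)
  then have "F z \<noteq> 0"
    using E_pos[of z] q p by (auto simp: E_def)
  then have "v z \<noteq> 0"
    using v_eq[of z] \<open>0 < z\<close> by (simp add: signed_powr_def)
  have "((\<lambda>u. (w u - w z) / (u - z)) \<longlongrightarrow> v z) (at z)"
    using w_deriv_at[OF \<open>0 < z\<close>] by (simp add: has_field_derivative_iff)
  then have "\<forall>\<^sub>F u in at z. (w u - w z) / (u - z) \<noteq> 0"
    using \<open>v z \<noteq> 0\<close> by (rule tendsto_imp_eventually_ne)
  then have "\<forall>\<^sub>F u in at z. u \<notin> Z"
    by (rule eventually_mono) (auto simp: Z_def \<open>w z = 0\<close>)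
  then show False
    using z by (simp add: islimpt_iff_eventually)
qed

section \<open>Logarithmic time and decay of the solution to zero\<close>

definition W :: "real \<Rightarrow> real" where
  "W t = w (exp t)"

lemma W_deriv_v: "(W has_real_derivative exp t * v (exp t)) (at t)"
  unfolding W_def[abs_def] mult.commute[of "exp t"]
  by (rule DERIV_chain2[where g = exp and x = t, OF w_deriv_at DERIV_exp]) simp

lemma F_exp_deriv: "((\<lambda>t. F (exp t)) has_real_derivative exp t * F' (exp t)) (at t)"
  unfolding mult.commute[of "exp t"]
  by (rule DERIV_chain2[where g = exp and x = t, OF F_deriv_at DERIV_exp]) simp

lemma continuous_W: "continuous_on A W"
  by (rule DERIV_continuous_on[OF has_field_derivative_at_within[OF W_deriv_v]])

text \<open>The function \<open>w + F / r\<close> differs from \<open>w\<close> by a vanishing term and obeys a damped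
  first order equation in \<open>ln r\<close>.\<close>

lemma W_eventually_le:
  assumes "0 < d"
  shows "\<forall>\<^sub>F t in at_top. W t \<le> 2 * d"
proof -
  obtain M where M: "0 < M" "\<And>r. 0 \<le> r \<Longrightarrow> \<bar>F r\<bar> \<le> M"
    using F_bounded by blast
  \<comment> \<open>\<open>b\<close> will bound the flux term \<open>F / r\<close>. The entry
    \<open>d / 2\<close> gives \<open>W t \<ge> d / 2\<close> when \<open>J t \<ge> d\<close>; the
    other keeps \<open>n * b\<close> below half of the damping
    \<open>\<alpha> * d / 2\<close>.\<close>
  define b where "b = min (d / 2) (\<alpha> * d / (4 * n))"
  have b: "0 < b" "b \<le> d / 2" "n * b \<le> \<alpha> * d / 4"
  proof -
    show "0 < b"
      using assms \<alpha> n by (simp add: b_def)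
    have "n * b \<le> n * (\<alpha> * d / (4 * n))"
      using n by (intro mult_left_mono) (auto simp: b_def)
    then show "n * b \<le> \<alpha> * d / 4"
      using n by simp
  qed (simp add: b_def)
  define T where "T = ln (M / b)"
  have small: "\<bar>F (exp t) * exp (- t)\<bar> \<le> b" if "T \<le> t" for t
  proof -
    have "M / b = exp T"
      using M b by (simp add: T_def)
    also have "\<dots> \<le> exp t"
      using that by simp
    finally have "M / b \<le> exp t" .
    then have "M \<le> b * exp t"
      using b by (simp add: field_simps)
    then have "\<bar>F (exp t)\<bar> \<le> b * exp t"
      using M(2)[of "exp t"] by simp
    then show ?thesis
      by (simp add: abs_mult exp_minus field_simps)
  qed
  define J where "J t = W t + F (exp t) * exp (- t)" for t
  define J' where "J' t = - n * (F (exp t) * exp (- t)) - \<alpha> * W t - signed_powr (q - 1) (W t)" for t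
  have J_deriv: "(J has_real_derivative J' t) (at t)" for t
  proof -
    have 1: "((\<lambda>t. exp (- t)) has_real_derivative - exp (- t)) (at t)"
      by (auto intro!: derivative_eq_intros)
    have "exp t * v (exp t) + (F (exp t) * - exp (- t) + exp t * F' (exp t) * exp (- t))
        = exp t * v (exp t) + F' (exp t) - F (exp t) * exp (- t)"
      by (simp add: exp_minus)
    also have "\<dots> = J' t"
      using ode[of "exp t"] by (simp add: J'_def W_def exp_minus field_simps)
    finally show ?thesis
      unfolding J_def using DERIV_add[OF W_deriv_v DERIV_mult'[OF F_exp_deriv 1]] by simp
  qed
  have "J' t \<le> - (\<alpha> * d / 4)" if "T \<le> t" "d \<le> J t" for t
  proof -
    have "d / 2 \<le> W t"
      using that small[of t] b unfolding J_def by linarith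
    then have "\<alpha> * (d / 2) \<le> \<alpha> * W t" "0 \<le> signed_powr (q - 1) (W t)"
      using \<alpha> assms by (auto simp: signed_powr_def)
    moreover have "n * (- (F (exp t) * exp (- t))) \<le> n * b"
      using small[OF that(1)] n by (intro mult_left_mono) auto
    ultimately show ?thesis
      unfolding J'_def using b by simp
  qed
  then obtain T' where T': "T \<le> T'" "\<And>t. T' \<le> t \<Longrightarrow> J t \<le> d"
    using eventually_le_of_deriv[of T J J' d "\<alpha> * d / 4"] J_deriv \<alpha> assms by auto
  show ?thesis
    unfolding eventually_at_top_linorder
  proof (intro exI allI impI)
    fix t assume "T' \<le> t"
    then show "W t \<le> 2 * d"
      using T' small[of t] b assms unfolding J_def by (smt (verit) field_sum_of_halves)
  qed
qed

lemma W_tendsto: "(W \<longlongrightarrow> 0) at_top"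
proof -
  interpret m: radial_solution n p q \<alpha> "\<lambda>r. - w r" "\<lambda>r. - v r" "\<lambda>r. - F r" "\<lambda>r. - F' r"
    by (rule uminus)
  show ?thesis
    unfolding tendsto_iff
  proof (intro allI impI)
    fix d :: real assume "0 < d"
    then have "\<forall>\<^sub>F t in at_top. W t \<le> 2 * (d / 4)" "\<forall>\<^sub>F t in at_top. m.W t \<le> 2 * (d / 4)"
      by (intro W_eventually_le m.W_eventually_le; simp)+
    then show "\<forall>\<^sub>F t in at_top. dist (W t) 0 < d"
      by eventually_elim (use \<open>0 < d\<close> in \<open>auto simp: m.W_def W_def\<close>)
  qed
qed

section \<open>The slope in logarithmic time\<close>

definition \<eta> :: real where
  "\<eta> = (n - p) / (p - 1)"

definition g :: "real \<Rightarrow> real" where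
  "g = signed_powr ((2 - p) / (p - 1))"

text \<open>Where \<open>W t > 0\<close> this is \<open>signed_powr (p - 2) \<zeta>\<close> with
  \<open>\<zeta> = - r * w' / w\<close>; in this form it inherits differentiability from
  \<open>F\<close>.\<close>

definition X :: "real \<Rightarrow> real" where
  "X t = - F (exp t) * (exp ((p - 1) * t) * W t powr (1 - p))"

lemma g_le_iff: "g a \<le> g b \<longleftrightarrow> a \<le> b"
  unfolding g_def by (rule signed_powr_le_iff) (rule exponent)

lemma g_less_iff: "g a < g b \<longleftrightarrow> a < b"
  unfolding g_def by (rule signed_powr_less_iff) (rule exponent)

lemma g_powr: "0 < a \<Longrightarrow> g (a powr (p - 1)) = a"
  using p by (simp add: g_def signed_powr_pos exponent powr_powr)

lemma g_X:
  assumes "0 < W t"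
  shows "g (X t) * W t = - (exp t * v (exp t))"
proof -
  have "X t = (exp ((p - 1) * t) * W t powr (1 - p)) * - F (exp t)"
    by (simp add: X_def)
  also have "g \<dots> = (exp ((p - 1) * t) * W t powr (1 - p)) powr (1 / (p - 1)) * g (- F (exp t))"
    unfolding g_def using assms by (subst signed_powr_mult) (simp_all add: exponent)
  also have "g (- F (exp t)) = - v (exp t)"
    using v_eq[of "exp t"] by (simp add: g_def)
  also have "(exp ((p - 1) * t) * W t powr (1 - p)) powr (1 / (p - 1)) = exp t * W t powr (- 1)"
  proof -
    have "(1 - p) * (1 / (p - 1)) = - 1"
      using p by (simp add: field_simps)
    then have "(W t powr (1 - p)) powr (1 / (p - 1)) = W t powr (- 1)"
      by (simp only: powr_powr)
    moreover have "exp ((p - 1) * t) powr (1 / (p - 1)) = exp t"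
      using p by (simp add: powr_def)
    ultimately show ?thesis
      by (simp add: powr_mult)
  qed
  finally show ?thesis
    using assms by (simp add: powr_minus)
qed

lemma W_deriv: "0 < W t \<Longrightarrow> (W has_real_derivative - g (X t) * W t) (at t)"
  using W_deriv_v[of t] by (simp add: g_X)

lemma X_deriv:
  assumes "0 < W t"
  shows "(X has_real_derivative
    exp (p * t) * W t powr (2 - p) * (\<alpha> + \<bar>W t\<bar> powr (q - 1) - g (X t))
    - (p - 1) * X t * (\<eta> - g (X t))) (at t)"
proof -
  define P where "P = exp ((p - 1) * t) * W t powr (1 - p)"
  have "((\<lambda>t. W t powr (1 - p)) has_real_derivative
      (1 - p) * W t powr (1 - p - 1) * (- g (X t) * W t)) (at t)"
    by (rule DERIV_chain2[OF has_real_derivative_powr[OF assms] W_deriv[OF assms]])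
  also have "(1 - p) * W t powr (1 - p - 1) * (- g (X t) * W t)
      = (p - 1) * g (X t) * (W t powr (1 - p - 1) * W t)"
    by (simp add: algebra_simps)
  also have "W t powr (1 - p - 1) * W t = W t powr (1 - p)"
    using assms powr_add[of "W t" "1 - p - 1" 1] by simp
  finally have Wp: "((\<lambda>t. W t powr (1 - p)) has_real_derivative
      (p - 1) * g (X t) * W t powr (1 - p)) (at t)" .
  have ex: "((\<lambda>t. exp ((p - 1) * t)) has_real_derivative (p - 1) * exp ((p - 1) * t)) (at t)"
    by (auto intro!: derivative_eq_intros)
  have "((\<lambda>t. exp ((p - 1) * t) * W t powr (1 - p)) has_real_derivative
      exp ((p - 1) * t) * ((p - 1) * g (X t) * W t powr (1 - p))
      + (p - 1) * exp ((p - 1) * t) * W t powr (1 - p)) (at t)"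
    by (rule DERIV_mult'[OF ex Wp])
  also have "exp ((p - 1) * t) * ((p - 1) * g (X t) * W t powr (1 - p))
      + (p - 1) * exp ((p - 1) * t) * W t powr (1 - p) = (p - 1) * (1 + g (X t)) * P"
    by (simp add: P_def algebra_simps)
  finally have P': "((\<lambda>t. exp ((p - 1) * t) * W t powr (1 - p)) has_real_derivative
      (p - 1) * (1 + g (X t)) * P) (at t)" .
  have "((\<lambda>t. - F (exp t) * (exp ((p - 1) * t) * W t powr (1 - p))) has_real_derivative
      - F (exp t) * ((p - 1) * (1 + g (X t)) * P)
      + - (exp t * F' (exp t)) * (exp ((p - 1) * t) * W t powr (1 - p))) (at t)"
    by (rule DERIV_mult'[OF DERIV_minus[OF F_exp_deriv] P'])
  moreover have "- F (exp t) * ((p - 1) * (1 + g (X t)) * P)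
      + - (exp t * F' (exp t)) * (exp ((p - 1) * t) * W t powr (1 - p))
      = exp (p * t) * W t powr (2 - p) * (\<alpha> + \<bar>W t\<bar> powr (q - 1) - g (X t))
        - (p - 1) * X t * (\<eta> - g (X t))"
  proof -
    have XP: "X t = - F (exp t) * P"
      by (simp add: X_def P_def)
    have "exp t * F' (exp t) = - ((n - 1) * F (exp t)) - exp t * (exp t * v (exp t))
        - exp t * (\<alpha> * W t + \<bar>W t\<bar> powr (q - 1) * W t)"
      using ode[of "exp t"] by (simp add: W_def signed_powr_def field_simps)
    also have "exp t * v (exp t) = - (g (X t) * W t)"
      using g_X[OF assms] by simp
    finally have F': "- (exp t * F' (exp t))
        = (n - 1) * F (exp t) + exp t * W t * (\<alpha> + \<bar>W t\<bar> powr (q - 1) - g (X t))"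
      by (simp add: algebra_simps)
    have "exp t * W t * P = exp (p * t) * W t powr (2 - p)"
    proof -
      have "exp t * exp ((p - 1) * t) = exp (p * t)"
        by (simp add: exp_add[symmetric] algebra_simps)
      moreover have "W t * W t powr (1 - p) = W t powr (2 - p)"
        using assms powr_add[of "W t" 1 "1 - p"] by simp
      moreover have "exp t * W t * P = (exp t * exp ((p - 1) * t)) * (W t * W t powr (1 - p))"
        by (simp add: P_def)
      ultimately show ?thesis
        by simp
    qed
    moreover have "(p - 1) * \<eta> = n - p"
      using p by (simp add: \<eta>_def)
    then have "X t * (n - p - (p - 1) * g (X t)) = X t * ((p - 1) * \<eta> - (p - 1) * g (X t))"
      by simp
    then have "(p - 1) * X t * (\<eta> - g (X t)) = X t * (n - p - (p - 1) * g (X t))"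
      by (simp add: algebra_simps)
    moreover have "- (exp t * F' (exp t)) * P
        = - (n - 1) * X t + exp t * W t * P * (\<alpha> + \<bar>W t\<bar> powr (q - 1) - g (X t))"
      unfolding F' by (simp add: XP algebra_simps)
    ultimately show ?thesis
      by (simp only: P_def[symmetric]) (simp add: XP algebra_simps)
  qed
  ultimately show ?thesis
    unfolding X_def[abs_def] by simp
qed

text \<open>At the level \<open>m\<close> both terms of the derivative of \<open>X\<close> push
  down, so \<open>g (X t)\<close> stays below \<eta> while \<open>W\<close> is positive. Then
  \<open>exp (\<eta> * t) * W t\<close> is nondecreasing, which prevents \<open>W\<close> from
  reaching 0.\<close>

lemma persistence:
  assumes \<eta>: "\<alpha> < \<eta>"
    and small: "\<And>t. t\<^sub>0 \<le> t \<Longrightarrow> \<bar>W t\<bar> powr (q - 1) < (\<eta> - \<alpha>) / 2"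
    and init: "0 < W t\<^sub>0" "g (X t\<^sub>0) < \<eta>"
  obtains m where "0 < m" "g m < \<eta>" "\<And>t. t\<^sub>0 \<le> t \<Longrightarrow> 0 < W t" "\<And>t. t\<^sub>0 \<le> t \<Longrightarrow> X t \<le> m"
proof -
  define a where "a = (\<alpha> + \<eta>) / 2"
  have a: "0 < a" "\<alpha> < a" "a < \<eta>"
    using \<eta> \<alpha> by (auto simp: a_def)
  \<comment> \<open>The second entry ensures \<open>g m \<ge> a\<close>, the midpoint of \<alpha>
    and \<eta>, so that \<open>\<alpha> + \<bar>W t\<bar> powr (q - 1)\<close> stays below
    \<open>g m\<close>.\<close>
  define m where "m = max (X t\<^sub>0) (a powr (p - 1))"
  have "0 < m"
    using a by (simp add: m_def less_max_iff_disj)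
  have gm: "a \<le> g m" "g m < \<eta>"
    using init a g_powr[OF a(1)] g_le_iff[of "a powr (p - 1)" m] by (auto simp: m_def max_def)
  have X_le: "X b \<le> m" if b: "t\<^sub>0 \<le> b" "\<And>t. t\<^sub>0 \<le> t \<Longrightarrow> t \<le> b \<Longrightarrow> 0 < W t" for b
  proof (rule barrier[OF b(1) X_deriv[OF b(2)]])
    fix t assume t: "t\<^sub>0 \<le> t" "t \<le> b" "X t = m"
    have "exp (p * t) * W t powr (2 - p) * (\<alpha> + \<bar>W t\<bar> powr (q - 1) - g m) \<le> 0"
      using small[OF t(1)] gm(1) by (intro mult_nonneg_nonpos) (auto simp: a_def field_simps)
    moreover have "0 < (p - 1) * m * (\<eta> - g m)"
      using p \<open>0 < m\<close> gm by simp
    ultimately show "exp (p * t) * W t powr (2 - p) * (\<alpha> + \<bar>W t\<bar> powr (q - 1) - g (X t))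
        - (p - 1) * X t * (\<eta> - g (X t)) < 0"
      using t by simp
  qed (auto simp: m_def)
  have "0 < W b" if b: "t\<^sub>0 \<le> b" for b
  proof (rule ccontr)
    assume "\<not> 0 < W b"
    \<comment> \<open>Half of the lower bound that monotonicity yields on
      \<open>[t\<^sub>0, b]\<close>. Stopping at this positive level rather than at 0 keeps
      \<open>W\<close> positive up to and including the hitting time.\<close>
    define c where "c = exp (\<eta> * (t\<^sub>0 - b)) * W t\<^sub>0 / 2"
    have "0 < c"
      using init by (simp add: c_def)
    have "\<eta> * (t\<^sub>0 - b) \<le> 0"
      using a b by (intro mult_nonneg_nonpos) auto
    then have "exp (\<eta> * (t\<^sub>0 - b)) * W t\<^sub>0 \<le> 1 * W t\<^sub>0"
      using init by (intro mult_right_mono) auto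
    then have "c < W t\<^sub>0"
      using init unfolding c_def by linarith
    then obtain s where s: "t\<^sub>0 < s" "s \<le> b" "W s = c" "\<And>t. t\<^sub>0 \<le> t \<Longrightarrow> t < s \<Longrightarrow> c < W t"
      using first_hit[OF b continuous_W, of c] \<open>0 < c\<close> \<open>\<not> 0 < W b\<close> by (auto simp: not_less)
    have W_pos: "0 < W t" if "t\<^sub>0 \<le> t" "t \<le> s" for t
      using s(3) s(4)[of t] that \<open>0 < c\<close> by (cases "t = s") auto
    have "exp (\<eta> * t\<^sub>0) * W t\<^sub>0 \<le> exp (\<eta> * s) * W s"
    proof (rule DERIV_nonneg_imp_nondecreasing[where f = "\<lambda>t. exp (\<eta> * t) * W t"])
      fix t assume t: "t\<^sub>0 \<le> t" "t \<le> s"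
      have "X t \<le> m"
        using t W_pos by (intro X_le) auto
      then have "g (X t) \<le> g m"
        by (simp add: g_le_iff)
      then have "0 \<le> (\<eta> - g (X t)) * (exp (\<eta> * t) * W t)"
        using gm W_pos[OF t] by (intro mult_nonneg_nonneg) auto
      moreover have "((\<lambda>t. exp (\<eta> * t) * W t) has_real_derivative
          (\<eta> - g (X t)) * (exp (\<eta> * t) * W t)) (at t)"
        using W_deriv[OF W_pos[OF t]] by (auto intro!: derivative_eq_intros simp: algebra_simps)
      ultimately show "\<exists>y. ((\<lambda>t. exp (\<eta> * t) * W t) has_real_derivative y) (at t) \<and> 0 \<le> y"
        by blast
    qed (use s in auto)
    also have "\<dots> \<le> exp (\<eta> * b) * W s"
      using s a \<open>0 < c\<close> by (intro mult_right_mono) auto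
    finally have "exp (\<eta> * (t\<^sub>0 - b)) * W t\<^sub>0 \<le> W s"
      by (simp add: right_diff_distrib exp_diff field_simps)
    then show False
      using s(3) \<open>0 < c\<close> unfolding c_def by linarith
  qed
  then show thesis
    using that[of m] X_le gm \<open>0 < m\<close> by auto
qed

section \<open>Late times: sign changes and the two decay rates\<close>

lemma eventually_small:
  assumes "\<alpha> < \<eta>"
  obtains T where "\<And>t. T \<le> t \<Longrightarrow> \<bar>W t\<bar> powr (q - 1) < (\<eta> - \<alpha>) / 2"
proof -
  have "((\<lambda>t. \<bar>W t\<bar> powr (q - 1)) \<longlongrightarrow> \<bar>0\<bar> powr (q - 1)) at_top"
    using q by (intro tendsto_powr' tendsto_intros W_tendsto) auto
  then have "\<forall>\<^sub>F t in at_top. \<bar>W t\<bar> powr (q - 1) < (\<eta> - \<alpha>) / 2"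
    by (rule order_tendstoD) (use assms in simp)
  then show thesis
    using that by (auto simp: eventually_at_top_linorder)
qed

text \<open>If \<open>W t\<^sub>2 \<le> 0\<close>, the maximum over the interval is positive and
  interior. The slope is 0 there, hence below \<eta>, and \<open>persistence\<close> keeps
  \<open>W\<close> positive from then on.\<close>

lemma no_return_to_zero:
  assumes \<eta>: "\<alpha> < \<eta>"
    and small: "\<And>t. t\<^sub>1 \<le> t \<Longrightarrow> \<bar>W t\<bar> powr (q - 1) < (\<eta> - \<alpha>) / 2"
    and t: "t\<^sub>1 < u" "u < t\<^sub>2" "W t\<^sub>1 = 0" "0 < W u"
  shows "0 < W t\<^sub>2"
proof (rule ccontr)
  assume neg: "\<not> 0 < W t\<^sub>2"
  obtain s where s: "s \<in> {t\<^sub>1..t\<^sub>2}" "\<And>t. t \<in> {t\<^sub>1..t\<^sub>2} \<Longrightarrow> W t \<le> W s"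
    using continuous_attains_sup[of "{t\<^sub>1..t\<^sub>2}" W] continuous_W t by force
  have "0 < W s"
    using s(2)[of u] t by auto
  then have s12: "t\<^sub>1 < s" "s < t\<^sub>2"
    using s(1) t(3) neg by (auto simp: less_le)
  have "exp s * v (exp s) = 0"
  proof (rule DERIV_local_max[OF W_deriv_v])
    show "0 < min (s - t\<^sub>1) (t\<^sub>2 - s)"
      using s12 by simp
    show "\<forall>y. \<bar>s - y\<bar> < min (s - t\<^sub>1) (t\<^sub>2 - s) \<longrightarrow> W y \<le> W s"
      using s(2) by (auto simp: abs_less_iff)
  qed
  then have "g (X s) = 0"
    using g_X[OF \<open>0 < W s\<close>] \<open>0 < W s\<close> by simp
  then have "g (X s) < \<eta>"
    using \<eta> \<alpha> by simp
  then obtain m where "\<And>t. s \<le> t \<Longrightarrow> 0 < W t"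
    using persistence[OF \<eta> small \<open>0 < W s\<close>] s12 by (metis less_eq_real_def order_trans)
  then show False
    using neg s12 by auto
qed

text \<open>A slope below \<eta> at one late time puts the rest of the trajectory into
  \<open>positive_phase\<close>; the identity \<open>\<delta> * (2 - p) = p\<close> turns the
  prefactor \<open>exp (p * t) * W t powr (2 - p)\<close> into \<open>s\<close>.\<close>

lemma slow_decay:
  assumes exps: "p / (2 - p) < \<alpha>" "\<alpha> < \<eta>"
    and small: "\<And>t. T \<le> t \<Longrightarrow> \<bar>W t\<bar> powr (q - 1) < (\<eta> - \<alpha>) / 2"
    and init: "0 < W T" "g (X T) < \<eta>"
  defines "\<delta> \<equiv> p / (2 - p)"
  shows "((\<lambda>t. exp (\<delta> * t) * W t) \<longlongrightarrow>
    (\<delta> powr (p - 1) * ((\<delta> - n) / (\<delta> - \<alpha>))) powr (1 / (2 - p))) at_top"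
proof -
  obtain m where m: "0 < m" "g m < \<eta>" "\<And>t. T \<le> t \<Longrightarrow> 0 < W t" "\<And>t. T \<le> t \<Longrightarrow> X t \<le> m"
    using persistence[OF exps(2) small init] by metis
  have "0 < \<delta>" "\<delta> < \<alpha>"
    using p exps by (auto simp: \<delta>_def)
  have \<delta>p: "\<delta> * (2 - p) = p"
    using p by (simp add: \<delta>_def)
  interpret P: positive_phase p \<delta> \<alpha> \<eta> "\<delta> * (q - 1)" "q - 1" m T "\<lambda>t. exp (\<delta> * t) * W t" X
  proof
    fix t assume t: "T \<le> t"
    have Wt: "0 < W t"
      using m t by simp
    show "((\<lambda>t. exp (\<delta> * t) * W t) has_real_derivative
        exp (\<delta> * t) * W t * (\<delta> - signed_powr ((2 - p) / (p - 1)) (X t))) (at t)"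
      using W_deriv[OF Wt] by (auto intro!: derivative_eq_intros simp: g_def algebra_simps)
    have "(exp (\<delta> * t) * W t) powr (2 - p) = exp (p * t) * W t powr (2 - p)"
      using Wt \<delta>p by (simp add: powr_mult powr_def[of "exp _"] mult.commute mult.left_commute)
    moreover have "exp (- (\<delta> * (q - 1)) * t) * (exp (\<delta> * t) * W t) powr (q - 1) = \<bar>W t\<bar> powr (q - 1)"
      using Wt by (simp add: powr_mult powr_def[of "exp _"] algebra_simps mult_exp_exp)
    ultimately show "(X has_real_derivative
        (exp (\<delta> * t) * W t) powr (2 - p) *
          (\<alpha> + exp (- (\<delta> * (q - 1)) * t) * (exp (\<delta> * t) * W t) powr (q - 1)
            - signed_powr ((2 - p) / (p - 1)) (X t))
        - (p - 1) * X t * (\<eta> - signed_powr ((2 - p) / (p - 1)) (X t))) (at t)"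
      using X_deriv[OF Wt] by (simp only: g_def)
  qed (use p q exps m \<open>0 < \<delta>\<close> \<open>\<delta> < \<alpha>\<close> in \<open>auto simp: g_def\<close>)
  \<comment> \<open>Identification of \<open>P.s\<^sub>0\<close> with the stated constant, via
    \<open>(p - 1) * (\<eta> - \<delta>) = n - \<delta>\<close>.\<close>
  have "(p - 1) * \<eta> = n - p"
    using p by (simp add: \<eta>_def)
  then have "(p - 1) * (\<eta> - \<delta>) = n - \<delta>"
    using \<delta>p by (simp add: algebra_simps)
  then have "P.s\<^sub>0 = \<delta> powr (p - 1) * ((n - \<delta>) / (\<alpha> - \<delta>))"
    unfolding P.s\<^sub>0_def P.x\<^sub>0_def by (metis mult.assoc mult.commute times_divide_eq_right)
  also have "(n - \<delta>) / (\<alpha> - \<delta>) = (\<delta> - n) / (\<delta> - \<alpha>)"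
    using minus_divide_divide[of "n - \<delta>" "\<alpha> - \<delta>"] by simp
  finally have "P.s\<^sub>0 = \<delta> powr (p - 1) * ((\<delta> - n) / (\<delta> - \<alpha>))" .
  with P.y_tendsto show ?thesis
    by simp
qed

text \<open>Monotonicity of \<open>exp (\<eta> * t) * W t\<close> gives a limit; the issue is
  positivity. The weighted flux \<open>\<Phi>\<close> has an integrable relative loss rate since
  \<open>n < \<eta>\<close>, so it stays above a positive constant, and integrating
  \<open>w'\<close> back from infinity bounds \<open>exp (\<eta> * t) * W t\<close> below.\<close>

lemma fast_decay:
  assumes \<eta>: "n < \<eta>" "\<alpha> < \<eta>"
    and small: "\<And>t. T \<le> t \<Longrightarrow> \<bar>W t\<bar> powr (q - 1) < (\<eta> - \<alpha>) / 2"
    and W_pos: "\<And>t. T \<le> t \<Longrightarrow> 0 < W t"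
    and X_ge: "\<And>t. T \<le> t \<Longrightarrow> \<eta> \<le> g (X t)"
  obtains c where "0 < c" "((\<lambda>t. exp (\<eta> * t) * W t) \<longlongrightarrow> c) at_top"
proof -
  define \<Phi> where "\<Phi> t = - F (exp t) * exp ((n - 1) * t)" for t
  define b where "b = (2 - p) / (p - 1)"
  define \<mu> where "\<mu> = \<eta> - n"
  have "0 < \<mu>" "0 < \<eta>" "0 < b"
    using \<eta> n p by (auto simp: \<mu>_def b_def)
  have g\<Phi>: "g (\<Phi> t) = exp (\<eta> * t) * (g (X t) * W t)" if "T \<le> t" for t
  proof -
    have "\<Phi> t = exp ((n - 1) * t) * - F (exp t)"
      by (simp add: \<Phi>_def)
    also have "g \<dots> = exp ((n - 1) * t) powr (1 / (p - 1)) * g (- F (exp t))"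
      unfolding g_def by (subst signed_powr_mult) (simp_all add: exponent)
    also have "g (- F (exp t)) = - v (exp t)"
      using v_eq[of "exp t"] by (simp add: g_def)
    also have "exp ((n - 1) * t) powr (1 / (p - 1)) = exp ((\<eta> + 1) * t)"
    proof -
      have "1 / (p - 1) * ((n - 1) * t) = (\<eta> + 1) * t"
        using p by (simp add: \<eta>_def field_simps)
      then show ?thesis
        by (simp add: powr_def)
    qed
    also have "\<dots> * - v (exp t) = exp (\<eta> * t) * (- (exp t * v (exp t)))"
      by (simp add: distrib_right exp_add)
    also have "- (exp t * v (exp t)) = g (X t) * W t"
      using g_X[OF W_pos[OF that]] by simp
    finally show ?thesis .
  qed
  have \<Phi>_pos: "0 < \<Phi> t" if "T \<le> t" for t
  proof -
    have "0 < g (X t) * W t"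
      using X_ge[OF that] W_pos[OF that] \<open>0 < \<eta>\<close> by (intro mult_pos_pos) auto
    then have "g 0 < g (\<Phi> t)"
      using g\<Phi>[OF that] by (simp add: g_def)
    then show ?thesis
      by (simp only: g_less_iff)
  qed
  define \<Phi>' where "\<Phi>' t = exp (n * t) * (W t * (\<alpha> + \<bar>W t\<bar> powr (q - 1) - g (X t)))" for t
  have \<Phi>_deriv: "(\<Phi> has_real_derivative \<Phi>' t) (at t)" if t: "T \<le> t" for t
  proof -
    have ex: "((\<lambda>t. exp ((n - 1) * t)) has_real_derivative (n - 1) * exp ((n - 1) * t)) (at t)"
      by (auto intro!: derivative_eq_intros)
    have "exp t * F' (exp t) = - ((n - 1) * F (exp t)) - exp t * (exp t * v (exp t))
        - exp t * (\<alpha> * W t + \<bar>W t\<bar> powr (q - 1) * W t)"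
      using ode[of "exp t"] by (simp add: W_def signed_powr_def field_simps)
    also have "exp t * v (exp t) = - (g (X t) * W t)"
      using g_X[OF W_pos[OF t]] by simp
    finally have F': "- (exp t * F' (exp t))
        = (n - 1) * F (exp t) + exp t * (W t * (\<alpha> + \<bar>W t\<bar> powr (q - 1) - g (X t)))"
      by (simp add: algebra_simps)
    have "- F (exp t) * ((n - 1) * exp ((n - 1) * t)) + - (exp t * F' (exp t)) * exp ((n - 1) * t)
        = (exp t * exp ((n - 1) * t)) * (W t * (\<alpha> + \<bar>W t\<bar> powr (q - 1) - g (X t)))"
      unfolding F' by (simp add: algebra_simps)
    also have "exp t * exp ((n - 1) * t) = exp (n * t)"
      by (simp add: exp_add[symmetric] algebra_simps)
    finally show ?thesis
      unfolding \<Phi>_def[abs_def] \<Phi>'_def using DERIV_mult'[OF DERIV_minus[OF F_exp_deriv] ex] by simp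
  qed
  have \<Phi>'_nonpos: "\<Phi>' t \<le> 0" if "T \<le> t" for t
    unfolding \<Phi>'_def using small[OF that] X_ge[OF that] W_pos[OF that] \<eta>
    by (intro mult_nonneg_nonpos) auto
  have \<Phi>_le: "\<Phi> t \<le> \<Phi> T" if "T \<le> t" for t
    using deriv_upper_bound_le[OF that, of \<Phi> \<Phi>' 0] \<Phi>_deriv \<Phi>'_nonpos by simp
  \<comment> \<open>Only the term with \<open>g (X t)\<close> is negative. It has size
    \<open>exp (- \<mu> * t) * g (\<Phi> t)\<close>, and
    \<open>g (\<Phi> t) \<le> \<Phi> T powr b * \<Phi> t\<close> because \<open>\<Phi>\<close>
    decreases.\<close>
  have \<Phi>'_ge: "- (\<Phi> T powr b * exp (- \<mu> * t)) * \<Phi> t \<le> \<Phi>' t" if t: "T \<le> t" for t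
  proof -
    have "exp (n * t) * (W t * g (X t)) = exp (- \<mu> * t) * (exp (\<eta> * t) * (g (X t) * W t))"
      by (simp add: \<mu>_def exp_add[symmetric] algebra_simps mult_exp_exp)
    also have "\<dots> = exp (- \<mu> * t) * (\<Phi> t powr b * \<Phi> t)"
      using \<Phi>_pos[OF t] by (simp add: g\<Phi>[OF t, symmetric]) (simp add: g_def signed_powr_def b_def)
    also have "\<dots> \<le> exp (- \<mu> * t) * (\<Phi> T powr b * \<Phi> t)"
      using \<Phi>_pos[OF t] \<Phi>_le[OF t] \<open>0 < b\<close> by (intro mult_left_mono mult_right_mono powr_mono2) auto
    finally have "- (\<Phi> T powr b * exp (- \<mu> * t)) * \<Phi> t \<le> - (exp (n * t) * (W t * g (X t)))"
      by (simp add: algebra_simps)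
    moreover have "0 \<le> exp (n * t) * (W t * (\<alpha> + \<bar>W t\<bar> powr (q - 1)))"
      using W_pos[OF t] \<alpha> by (intro mult_nonneg_nonneg) auto
    ultimately show ?thesis
      unfolding \<Phi>'_def by (simp add: algebra_simps)
  qed
  \<comment> \<open>Lower bound obtained by integrating the relative loss rate
    \<open>\<Phi> T powr b * exp (- \<mu> * t)\<close> from \<open>T\<close> to infinity.\<close>
  define \<phi> where "\<phi> = exp (ln (\<Phi> T) - \<Phi> T powr b / \<mu> * exp (- \<mu> * T))"
  have \<Phi>_ge: "\<phi> \<le> \<Phi> t" if t: "T \<le> t" for t
  proof -
    have "ln (\<Phi> T) - \<Phi> T powr b / \<mu> * exp (- \<mu> * T) \<le> ln (\<Phi> t) - \<Phi> T powr b / \<mu> * exp (- \<mu> * t)"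
    proof (rule DERIV_nonneg_imp_nondecreasing[OF t])
      fix u assume "T \<le> u" "u \<le> t"
      have ln': "((\<lambda>t. ln (\<Phi> t)) has_real_derivative 1 / \<Phi> u * \<Phi>' u) (at u)"
        using DERIV_chain2[OF DERIV_ln_divide \<Phi>_deriv] \<Phi>_pos \<open>T \<le> u\<close> by auto
      have ex: "((\<lambda>t. \<Phi> T powr b / \<mu> * exp (- \<mu> * t)) has_real_derivative
          - (\<Phi> T powr b * exp (- \<mu> * u))) (at u)"
        using \<open>0 < \<mu>\<close> by (auto intro!: derivative_eq_intros)
      have "0 \<le> 1 / \<Phi> u * \<Phi>' u - - (\<Phi> T powr b * exp (- \<mu> * u))"
        using \<Phi>'_ge[OF \<open>T \<le> u\<close>] \<Phi>_pos[OF \<open>T \<le> u\<close>] by (simp add: field_simps)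
      then show "\<exists>y. ((\<lambda>t. ln (\<Phi> t) - \<Phi> T powr b / \<mu> * exp (- \<mu> * t)) has_real_derivative y) (at u) \<and> 0 \<le> y"
        using DERIV_diff[OF ln' ex] by blast
    qed
    moreover have "0 \<le> \<Phi> T powr b / \<mu> * exp (- \<mu> * t)"
      using \<open>0 < \<mu>\<close> by simp
    ultimately have "ln (\<Phi> T) - \<Phi> T powr b / \<mu> * exp (- \<mu> * T) \<le> ln (\<Phi> t)"
      by linarith
    then have "\<phi> \<le> exp (ln (\<Phi> t))"
      unfolding \<phi>_def by (simp only: exp_le_cancel_iff)
    then show ?thesis
      using \<Phi>_pos[OF t] by simp
  qed
  have "0 < g \<phi>"
    using g_less_iff[of 0 \<phi>] by (simp add: \<phi>_def) (simp add: g_def)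
  \<comment> \<open>Since \<open>W\<close> tends to 0, integrating
    \<open>g \<phi> * exp (- \<eta> * u)\<close>, a lower bound for the rate of decrease of
    \<open>W\<close>, over \<open>u \<ge> t\<close> gives
    \<open>W t \<ge> d * exp (- \<eta> * t)\<close>.\<close>
  define d where "d = g \<phi> / \<eta>"
  have "0 < d"
    using \<open>0 < g \<phi>\<close> \<open>0 < \<eta>\<close> by (simp add: d_def)
  define H where "H t = W t - d * exp (- \<eta> * t)" for t
  define H' where "H' t = - g (X t) * W t + g \<phi> * exp (- \<eta> * t)" for t
  have H_deriv: "(H has_real_derivative H' t) (at t)" if "T \<le> t" for t
    unfolding H_def[abs_def] H'_def using W_deriv[OF W_pos[OF that]] \<open>0 < \<eta>\<close>
    by (auto intro!: derivative_eq_intros simp: d_def)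
  have H'_nonpos: "H' t \<le> 0" if "T \<le> t" for t
  proof -
    have "g \<phi> * exp (- \<eta> * t) \<le> g (\<Phi> t) * exp (- \<eta> * t)"
      using \<Phi>_ge[OF that] g_le_iff[of \<phi> "\<Phi> t"] by (intro mult_right_mono) auto
    also have "\<dots> = g (X t) * W t"
      by (simp add: g\<Phi>[OF that] exp_minus)
    finally show ?thesis
      by (simp add: H'_def)
  qed
  have "LIM t at_top. - \<eta> * t :> at_bot"
    using \<open>0 < \<eta>\<close> by (intro filterlim_tendsto_neg_mult_at_bot[OF tendsto_const]) (auto simp: filterlim_ident)
  then have "((\<lambda>t. exp (- \<eta> * t)) \<longlongrightarrow> 0) at_top"
    by (rule filterlim_compose[OF exp_at_bot])
  then have "(H \<longlongrightarrow> 0 - d * 0) at_top"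
    unfolding H_def[abs_def] by (intro tendsto_intros W_tendsto)
  then have H_lim: "(H \<longlongrightarrow> 0) at_top"
    by simp
  have H_nonneg: "0 \<le> H t" if t: "T \<le> t" for t
  proof (rule tendsto_upperbound[OF H_lim])
    have "H u \<le> H t" if "t \<le> u" for u
      using deriv_upper_bound_le[OF that, of H H' 0] H_deriv H'_nonpos t by simp
    then show "\<forall>\<^sub>F u in at_top. H u \<le> H t"
      unfolding eventually_at_top_linorder by blast
  qed simp
  have "((\<lambda>t. exp (\<eta> * t) * W t) has_real_derivative (\<eta> - g (X t)) * (exp (\<eta> * t) * W t)) (at t)"
    if "T \<le> t" for t
    using W_deriv[OF W_pos[OF that]] by (auto intro!: derivative_eq_intros simp: algebra_simps)
  moreover have "(\<eta> - g (X t)) * (exp (\<eta> * t) * W t) \<le> 0" if "T \<le> t" for t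
    using X_ge[OF that] W_pos[OF that] by (intro mult_nonpos_nonneg) auto
  moreover have "d \<le> exp (\<eta> * t) * W t" if "T \<le> t" for t
    using H_nonneg[OF that] by (simp add: H_def exp_minus field_simps)
  ultimately obtain L where "d \<le> L" "((\<lambda>t. exp (\<eta> * t) * W t) \<longlongrightarrow> L) at_top"
    by (rule nonincreasing_bounded_tendsto)
  then show thesis
    using that[of L] \<open>0 < d\<close> by simp
qed

text \<open>The dichotomy is whether the slope is below \<eta> at some late time or at least \<eta>
  at all late times.\<close>

lemma positive_limits:
  assumes exps: "p / (2 - p) < \<alpha>" "\<alpha> < \<eta>" "n < \<eta>"
    and W_pos: "\<And>t. T \<le> t \<Longrightarrow> 0 < W t"
  defines "\<delta> \<equiv> p / (2 - p)"
  shows "((\<lambda>t. exp (\<delta> * t) * W t) \<longlongrightarrow>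
      (\<delta> powr (p - 1) * ((\<delta> - n) / (\<delta> - \<alpha>))) powr (1 / (2 - p))) at_top \<or>
    (\<exists>c. c \<noteq> 0 \<and> ((\<lambda>t. exp (\<eta> * t) * W t) \<longlongrightarrow> c) at_top)"
proof -
  obtain S where S: "\<And>t. S \<le> t \<Longrightarrow> \<bar>W t\<bar> powr (q - 1) < (\<eta> - \<alpha>) / 2"
    using eventually_small[OF exps(2)] by blast
  show ?thesis
  proof (cases "\<exists>t\<ge>max S T. g (X t) < \<eta>")
    case True
    then obtain t where t: "max S T \<le> t" "g (X t) < \<eta>"
      by blast
    then have "0 < W t"
      using W_pos by simp
    then have "((\<lambda>t. exp (\<delta> * t) * W t) \<longlongrightarrow>
        (\<delta> powr (p - 1) * ((\<delta> - n) / (\<delta> - \<alpha>))) powr (1 / (2 - p))) at_top"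
      unfolding \<delta>_def using S t by (intro slow_decay[of t] exps) auto
    then show ?thesis
      by simp
  next
    case False
    then obtain c where "0 < c" "((\<lambda>t. exp (\<eta> * t) * W t) \<longlongrightarrow> c) at_top"
      using fast_decay[OF exps(3,2), of "max S T"] S W_pos by (metis max.boundedE not_less)
    then show ?thesis
      by (intro disjI2 exI[of _ c]) auto
  qed
qed

text \<open>Past \<open>S\<close> there is at most one zero: between two zeros \<open>W\<close> or
  \<open>- W\<close> would be positive somewhere, against \<open>no_return_to_zero\<close>.\<close>

lemma eventually_nonzero:
  assumes \<eta>: "\<alpha> < \<eta>"
  obtains T where "\<And>t. T \<le> t \<Longrightarrow> W t \<noteq> 0"
proof -
  interpret m: radial_solution n p q \<alpha> "\<lambda>r. - w r" "\<lambda>r. - v r" "\<lambda>r. - F r" "\<lambda>r. - F' r"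
    by (rule uminus)
  have mW: "m.W t = - W t" for t
    by (simp add: m.W_def W_def)
  obtain S where S: "\<And>t. S \<le> t \<Longrightarrow> \<bar>W t\<bar> powr (q - 1) < (\<eta> - \<alpha>) / 2"
    using eventually_small[OF \<eta>] by blast
  have unique: False if t: "S \<le> t\<^sub>1" "t\<^sub>1 < t\<^sub>2" "W t\<^sub>1 = 0" "W t\<^sub>2 = 0" for t\<^sub>1 t\<^sub>2
  proof -
    \<comment> \<open>Finiteness of the zeros on compact intervals excludes that \<open>W\<close>
      vanishes on the whole gap.\<close>
    have "\<exists>u. t\<^sub>1 < u \<and> u < t\<^sub>2 \<and> W u \<noteq> 0"
    proof (rule ccontr)
      assume "\<not> ?thesis"
      then have "exp ` {t\<^sub>1<..<t\<^sub>2} \<subseteq> {r \<in> {0..exp t\<^sub>2}. w r = 0}"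
        by (auto simp: W_def)
      then have "finite (exp ` {t\<^sub>1<..<t\<^sub>2})"
        using finite_zeros_compact by (rule finite_subset)
      then have "finite {t\<^sub>1<..<t\<^sub>2}"
        by (rule finite_imageD) (auto simp: inj_on_def)
      then show False
        using t by (simp add: infinite_Ioo)
    qed
    then obtain u where u: "t\<^sub>1 < u" "u < t\<^sub>2" "W u \<noteq> 0"
      by blast
    have "\<bar>W t\<bar> powr (q - 1) < (\<eta> - \<alpha>) / 2" if "t\<^sub>1 \<le> t" for t
      using S t that by simp
    then show False
      using no_return_to_zero[OF \<eta>, of t\<^sub>1 u t\<^sub>2] m.no_return_to_zero[OF \<eta>, of t\<^sub>1 u t\<^sub>2] t u
      by (cases "0 < W u") (auto simp: mW)
  qed
  show thesis
  proof (cases "\<exists>t\<ge>S. W t = 0")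
    case True
    then obtain t\<^sub>1 where t\<^sub>1: "S \<le> t\<^sub>1" "W t\<^sub>1 = 0"
      by blast
    show thesis
    proof (rule that[of "t\<^sub>1 + 1"])
      show "W t \<noteq> 0" if "t\<^sub>1 + 1 \<le> t" for t
        using unique[OF t\<^sub>1(1) _ t\<^sub>1(2), of t] that by auto
    qed
  next
    case False
    then show thesis
      using that[of S] by blast
  qed
qed

lemma finite_zeros:
  assumes "\<alpha> < \<eta>"
  shows "finite {r. 0 \<le> r \<and> w r = 0}"
proof -
  obtain T where T: "\<And>t. T \<le> t \<Longrightarrow> W t \<noteq> 0"
    using eventually_nonzero[OF assms] by blast
  have "r \<le> exp T" if "0 \<le> r" "w r = 0" for r
  proof (rule ccontr)
    assume "\<not> r \<le> exp T"
    then have r: "exp T < r" "0 < r"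
      using exp_gt_zero[of T] by linarith+
    then have "T \<le> ln r"
      by (simp add: ln_ge_iff)
    then show False
      using T[of "ln r"] that r by (simp add: W_def)
  qed
  then have "{r. 0 \<le> r \<and> w r = 0} \<subseteq> {r \<in> {0..exp T}. w r = 0}"
    by auto
  then show ?thesis
    using finite_zeros_compact by (rule finite_subset)
qed

lemma limits:
  assumes exps: "p / (2 - p) < \<alpha>" "\<alpha> < \<eta>" "n < \<eta>"
  defines "\<delta> \<equiv> p / (2 - p)"
  defines "l \<equiv> (\<delta> powr (p - 1) * ((\<delta> - n) / (\<delta> - \<alpha>))) powr (1 / (2 - p))"
  shows "((\<lambda>t. exp (\<delta> * t) * W t) \<longlongrightarrow> l) at_top \<or>
    ((\<lambda>t. exp (\<delta> * t) * W t) \<longlongrightarrow> - l) at_top \<or>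
    (\<exists>c. c \<noteq> 0 \<and> ((\<lambda>t. exp (\<eta> * t) * W t) \<longlongrightarrow> c) at_top)"
proof -
  interpret m: radial_solution n p q \<alpha> "\<lambda>r. - w r" "\<lambda>r. - v r" "\<lambda>r. - F r" "\<lambda>r. - F' r"
    by (rule uminus)
  have mW: "m.W t = - W t" for t
    by (simp add: m.W_def W_def)
  obtain T where T: "\<And>t. T \<le> t \<Longrightarrow> W t \<noteq> 0"
    using eventually_nonzero[OF exps(2)] by blast
  show ?thesis
  proof (cases "0 < W T")
    case True
    have "0 < W t" if t: "T \<le> t" for t
    proof (rule ccontr)
      assume "\<not> 0 < W t"
      then obtain u where "T < u" "W u = 0"
        using first_hit[OF t continuous_W True] by (auto simp: not_less)
      then show False
        using T[of u] by simp
    qed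
    then show ?thesis
      unfolding l_def \<delta>_def using positive_limits[OF exps, of T] by blast
  next
    case False
    then have neg: "0 < m.W T"
      using T[of T] by (simp add: mW)
    have "0 < m.W t" if t: "T \<le> t" for t
    proof (rule ccontr)
      assume "\<not> 0 < m.W t"
      then obtain u where "T < u" "m.W u = 0"
        using first_hit[OF t m.continuous_W neg] by (auto simp: not_less)
      then show False
        using T[of u] by (simp add: mW)
    qed
    then consider "((\<lambda>t. exp (\<delta> * t) * m.W t) \<longlongrightarrow> l) at_top"
      | c where "c \<noteq> 0" "((\<lambda>t. exp (\<eta> * t) * m.W t) \<longlongrightarrow> c) at_top"
      unfolding l_def \<delta>_def using m.positive_limits[OF exps, of T] by blast
    then show ?thesis
    proof cases
      case 1
      then have "((\<lambda>t. exp (\<delta> * t) * W t) \<longlongrightarrow> - l) at_top"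
        using tendsto_minus[OF 1] by (simp add: mW)
      then show ?thesis
        by simp
    next
      case (2 c)
      then have "((\<lambda>t. exp (\<eta> * t) * W t) \<longlongrightarrow> - c) at_top"
        using tendsto_minus[OF 2(2)] by (simp add: mW)
      then show ?thesis
        using 2(1) by (intro disjI2 exI[of _ "- c"]) simp
    qed
  qed
qed

section \<open>Return to the radial variable and to the initial value problem\<close>

lemma tendsto_powr_of_exp:
  assumes "((\<lambda>t. exp (d * t) * W t) \<longlongrightarrow> L) at_top"
  shows "((\<lambda>r. r powr d * w r) \<longlongrightarrow> L) at_top"
proof (rule Lim_transform_eventually)
  show "((\<lambda>r. exp (d * ln r) * W (ln r)) \<longlongrightarrow> L) at_top"
    by (rule filterlim_compose[OF assms ln_at_top])
  show "\<forall>\<^sub>F r in at_top. exp (d * ln r) * W (ln r) = r powr d * w r"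
    using eventually_gt_at_top[of 0] by (rule eventually_mono) (simp add: W_def powr_def)
qed

end

lemma ivp_solution_imp_radial_solution:
  assumes "ivp_solution N p q \<alpha> a w" "a \<noteq> 0" "1 \<le> N" "1 < p" "p < 2" "1 < q" "0 < \<alpha>"
  obtains v F F' where "radial_solution (real N) p q \<alpha> w v F F'"
proof -
  obtain v F' where sol: "C1_halfline w v" "C1_halfline (\<lambda>r. signed_powr (p - 2) (v r)) F'"
    "\<And>r. 0 < r \<Longrightarrow> F' r + (real N - 1) / r * signed_powr (p - 2) (v r)
      + r * v r + \<alpha> * w r + signed_powr (q - 1) (w r) = 0" "w 0 = a"
    using assms(1) unfolding ivp_solution_def by blast
  have "radial_solution (real N) p q \<alpha> w v (\<lambda>r. signed_powr (p - 2) (v r)) F'"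
  proof
    show "v r = signed_powr ((2 - p) / (p - 1)) (signed_powr (p - 2) (v r))" for r
      using assms by (subst signed_powr_inverse) (simp_all add: field_simps)
  qed (use assms sol in \<open>auto simp: C1_halfline_def\<close>)
  then show thesis
    using that by blast
qed

theorem theorem4p6:
  fixes N :: nat and p q \<alpha> p\<^sub>1 p\<^sub>2 \<delta> \<eta> l :: real
  assumes "N \<ge> 1" and "p > 1" and "q > 1"
    and "p\<^sub>1 = 2 * real N / (real N + 1)"
    and "p\<^sub>2 = 2 * real N / (real N + 2)"
    and "p\<^sub>2 < p" and "p < p\<^sub>1"
    and "\<delta> = p / (2 - p)"
    and "\<eta> = (real N - p) / (p - 1)"
    and "\<delta> < \<alpha>"
    and "l = (\<delta> powr (p - 1) * ((\<delta> - real N) / (\<delta> - \<alpha>))) powr (1 / (2 - p))"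
  shows "(\<alpha> \<le> real N \<longrightarrow> \<alpha> < \<eta>) \<and>
    (\<alpha> < \<eta> \<longrightarrow>
      (\<forall>a w. a \<noteq> 0 \<and> ivp_solution N p q \<alpha> a w \<longrightarrow>
         finite {r. r \<ge> 0 \<and> w r = 0} \<and>
         ((((\<lambda>r. r powr \<delta> * w r) \<longlongrightarrow> l) at_top \<or>
           ((\<lambda>r. r powr \<delta> * w r) \<longlongrightarrow> - l) at_top) \<or>
          (\<exists>c. c \<noteq> 0 \<and> ((\<lambda>r. r powr \<eta> * w r) \<longlongrightarrow> c) at_top))))"
proof -
  have p_lt: "p * (real N + 1) < 2 * real N"
    using assms(4,7) by (simp add: pos_less_divide_eq)
  then have "p * (real N + 1) < 2 * (real N + 1)"
    by simp
  then have "p < 2"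
    by (rule mult_right_less_imp_less) simp
  have "0 < \<delta>"
    using assms(2,8) \<open>p < 2\<close> by simp
  then have "0 < \<alpha>"
    using assms(10) by simp
  \<comment> \<open>For \<open>p > 1\<close> this is equivalent to \<open>p < p\<^sub>1\<close>. It
    settles the case \<open>\<alpha> \<le> N\<close> and supplies the integrability needed for the
    fast decay.\<close>
  have "real N < \<eta>"
    using p_lt assms(2,9) by (simp add: pos_less_divide_eq algebra_simps)
  moreover have "finite {r. r \<ge> 0 \<and> w r = 0} \<and>
         ((((\<lambda>r. r powr \<delta> * w r) \<longlongrightarrow> l) at_top \<or>
           ((\<lambda>r. r powr \<delta> * w r) \<longlongrightarrow> - l) at_top) \<or>
          (\<exists>c. c \<noteq> 0 \<and> ((\<lambda>r. r powr \<eta> * w r) \<longlongrightarrow> c) at_top))"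
    if \<alpha>: "\<alpha> < \<eta>" and a: "a \<noteq> 0" and w: "ivp_solution N p q \<alpha> a w" for a w
  proof -
    obtain v F F' where "radial_solution (real N) p q \<alpha> w v F F'"
      using ivp_solution_imp_radial_solution[OF w a assms(1,2) \<open>p < 2\<close> assms(3) \<open>0 < \<alpha>\<close>] by blast
    then interpret R: radial_solution "real N" p q \<alpha> w v F F' .
    have \<eta>: "R.\<eta> = \<eta>"
      by (simp add: R.\<eta>_def assms(9))
    have "finite {r. r \<ge> 0 \<and> w r = 0}"
      using R.finite_zeros \<alpha> by (simp add: \<eta>)
    moreover have "((\<lambda>t. exp (\<delta> * t) * R.W t) \<longlongrightarrow> l) at_top \<or>
        ((\<lambda>t. exp (\<delta> * t) * R.W t) \<longlongrightarrow> - l) at_top \<or>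
        (\<exists>c. c \<noteq> 0 \<and> ((\<lambda>t. exp (\<eta> * t) * R.W t) \<longlongrightarrow> c) at_top)"
      using R.limits \<alpha> \<open>real N < \<eta>\<close> assms(10) unfolding \<eta> assms(8,11) by blast
    ultimately show ?thesis
      using R.tendsto_powr_of_exp by blast
  qed
  ultimately show ?thesis
    by auto
qed

end
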